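(* Let $n$ be a positive integer and let $$U=\mathbb{C}^{n}\setminus\bigcup_{1\leq i<j\leq n}\{(z_{1},\ldots,z_{n})\in\mathbb{C}^{n} \mid z_{i}=z_{j}=0\}$$ be the complement of the codimension-two coordinate subspace arrangement in $\mathbb{C}^{n}$. Then $U$ is homotopy equivalent to the wedge of spheres $$\bigvee_{k=2}^{n}(k-1)\binom{n}{k}S^{k+1}.$$
   Context: The codimension-two coordinate subspace arrangement in $\mathbb{C}^{n}$ is the collection of all complex coordinate subspaces $\{z_{i}=z_{j}=0\}$ with $1\leq i<j\leq n$ (codimension two refers to complex codimension). For a nonnegative integer $r$ and a based space $X$, the notation $rX$ inside a wedge means the wedge of $r$ copies of $X$; thus $(k-1)\binom{n}{k}S^{k+1}$ is the wedge of $(k-1)\binom{n}{k}$ copies of the sphere $S^{k+1}$. An empty wedge is a point. *)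

theory Defs
  imports "HOL-Analysis.Analysis"
begin

section \<open>The codimension-two coordinate subspace arrangement\<close>

text \<open>
  Points of complex \<open>n\<close>-space are the functions in \<open>{1..n} \<rightarrow>\<^sub>E UNIV\<close>, i.e. they take
  the fixed value \<open>undefined\<close> outside the index set \<open>{1..n}\<close>.
\<close>

definition complex_space :: "nat \<Rightarrow> (nat \<Rightarrow> complex) topology" where
  "complex_space n = product_topology (\<lambda>_. euclidean) {1..n}"

definition codim2_arrangement :: "nat \<Rightarrow> (nat \<Rightarrow> complex) set set" where
  "codim2_arrangement n =
     {{z \<in> topspace (complex_space n). z i = 0 \<and> z j = 0} | i j. 1 \<le> i \<and> i < j \<and> j \<le> n}"

definition codim2_complement :: "nat \<Rightarrow> (nat \<Rightarrow> complex) topology" where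
  "codim2_complement n =
     subtopology (complex_space n) (topspace (complex_space n) - \<Union>(codim2_arrangement n))"

section \<open>Wedge sums\<close>

text \<open>
  The wedge of a family \<open>X\<close> of spaces with base points \<open>b\<close>, indexed by \<open>I\<close>: the common
  base point is \<open>None\<close>, and a point \<open>x \<noteq> b i\<close> of the \<open>i\<close>-th summand is \<open>Some (i, x)\<close>.
  Hence the wedge of the empty family is the one-point space. The topology is the final
  one for the inclusions of the summands; for \<open>I \<noteq> {}\<close> this is the quotient topology
  on the disjoint union, see \<open>quotient_map_wedge\<close> below.
\<close>

definition wedge_incl :: "('i \<Rightarrow> 'a) \<Rightarrow> 'i \<Rightarrow> 'a \<Rightarrow> ('i \<times> 'a) option" where
  "wedge_incl b i x = (if x = b i then None else Some (i, x))"

definition wedge_carrier ::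
    "('i \<Rightarrow> 'a topology) \<Rightarrow> ('i \<Rightarrow> 'a) \<Rightarrow> 'i set \<Rightarrow> ('i \<times> 'a) option set" where
  "wedge_carrier X b I = insert None (\<Union>i\<in>I. wedge_incl b i ` topspace (X i))"

definition wedge ::
    "('i \<Rightarrow> 'a topology) \<Rightarrow> ('i \<Rightarrow> 'a) \<Rightarrow> 'i set \<Rightarrow> ('i \<times> 'a) option topology" where
  "wedge X b I = topology (\<lambda>W. W \<subseteq> wedge_carrier X b I \<and>
     (\<forall>i\<in>I. openin (X i) {x \<in> topspace (X i). wedge_incl b i x \<in> W}))"

lemma istopology_wedge:
  "istopology (\<lambda>W. W \<subseteq> wedge_carrier X b I \<and>
     (\<forall>i\<in>I. openin (X i) {x \<in> topspace (X i). wedge_incl b i x \<in> W}))"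
proof -
  have 1: "{x \<in> topspace (X i). wedge_incl b i x \<in> S \<inter> T} =
      {x \<in> topspace (X i). wedge_incl b i x \<in> S} \<inter> {x \<in> topspace (X i). wedge_incl b i x \<in> T}"
    for S T i by auto
  have 2: "{x \<in> topspace (X i). wedge_incl b i x \<in> \<Union>\<K>} =
      (\<Union>K\<in>\<K>. {x \<in> topspace (X i). wedge_incl b i x \<in> K})" for \<K> i
    by auto
  show ?thesis
    unfolding istopology_def 1 2 by blast
qed

lemma openin_wedge:
  "openin (wedge X b I) W \<longleftrightarrow> W \<subseteq> wedge_carrier X b I \<and>
     (\<forall>i\<in>I. openin (X i) {x \<in> topspace (X i). wedge_incl b i x \<in> W})"
  by (simp add: wedge_def istopology_wedge)

lemma topspace_wedge [simp]: "topspace (wedge X b I) = wedge_carrier X b I"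
proof -
  have "{x \<in> topspace (X i). wedge_incl b i x \<in> wedge_carrier X b I} = topspace (X i)"
    if "i \<in> I" for i
    using that by (auto simp: wedge_carrier_def)
  then have "openin (wedge X b I) (wedge_carrier X b I)"
    by (simp add: openin_wedge)
  then show ?thesis
    by (meson openin_subset openin_topspace openin_wedge subset_antisym)
qed

lemma quotient_map_wedge:
  assumes "I \<noteq> {}" and b: "\<And>i. i \<in> I \<Longrightarrow> b i \<in> topspace (X i)"
  shows "quotient_map (sum_topology X I) (wedge X b I) (\<lambda>(i, x). wedge_incl b i x)"
proof -
  obtain i where i: "i \<in> I"
    using assms(1) by blast
  have "None = wedge_incl b i (b i)"
    by (simp add: wedge_incl_def)
  with b[OF i] i have "None \<in> (\<Union>i\<in>I. wedge_incl b i ` topspace (X i))"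
    by blast
  then have "wedge_carrier X b I = (\<Union>i\<in>I. wedge_incl b i ` topspace (X i))"
    by (auto simp: wedge_carrier_def)
  also have "\<dots> = (\<lambda>(i, x). wedge_incl b i x) ` Sigma I (topspace \<circ> X)"
    by force
  finally have img: "(\<lambda>(i, x). wedge_incl b i x) ` Sigma I (topspace \<circ> X) = wedge_carrier X b I" ..
  have eq: "{x. (i, x) \<in> {p \<in> Sigma I (topspace \<circ> X). (case p of (i, x) \<Rightarrow> wedge_incl b i x) \<in> W}}
      = {x \<in> topspace (X i). wedge_incl b i x \<in> W}" if "i \<in> I" for i W
    using that by auto
  show ?thesis
    unfolding quotient_map_def openin_sum_topology openin_wedge topspace_wedge topspace_sum_topology
    using img eq by (auto cong: ball_cong)
qed

section \<open>Wedges of spheres\<close>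

definition sphere_base :: "nat \<Rightarrow> real" where
  "sphere_base = (\<lambda>i. if i = 0 then 1 else 0)"

lemma sphere_base_in_nsphere: "sphere_base \<in> topspace (nsphere m)"
  unfolding sphere_base_def by (rule in_topspace_nsphere)

text \<open>
  The wedge over \<open>k \<in> K\<close> of \<open>m k\<close> copies of the \<open>d k\<close>-dimensional sphere;
  the summand with index \<open>(k, j)\<close> is the \<open>j\<close>-th copy for \<open>k\<close>.
\<close>

definition wedge_of_spheres ::
    "nat set \<Rightarrow> (nat \<Rightarrow> nat) \<Rightarrow> (nat \<Rightarrow> nat) \<Rightarrow> ((nat \<times> nat) \<times> (nat \<Rightarrow> real)) option topology" where
  "wedge_of_spheres K m d =
     wedge (\<lambda>(k, j). nsphere (d k)) (\<lambda>_. sphere_base) (SIGMA k:K. {..<m k})"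

end

theory Submission
  imports Defs
begin

text \<open>
  The complement retracts onto the moment-angle complex \<open>M\<^sub>n\<close> of points with all coordinates
  in the closed unit ball and at most one of them in its interior. Pass from \<open>M\<^sub>m\<close> to
  \<open>M\<^sub>m\<^sub>+\<^sub>1\<close>: first glue in the points whose only interior coordinate is the last one, which does
  not change the homotopy type, and then, for each \<open>i \<le> m\<close>, a family of 3-cells (a disc in
  coordinate \<open>i\<close> times the open circle in the last coordinate) parametrised by the torus
  \<open>T\<^sup>m\<^sup>-\<^sup>1\<close> of the other coordinates. The attaching maps are null-homotopic, since the last
  coordinate can be contracted in its disc, then the coordinate \<open>i\<close>, then the others.

  A null-homotopic family of \<open>d\<close>-cells parametrised by \<open>T \<times> S\<^sup>1\<close> amounts to a null-homotopic
  family of \<open>d\<close>-cells over \<open>T\<close> followed by a null-homotopic family of \<open>(d + 1)\<close>-cells over \<open>T\<close>, so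
  each torus family adds \<open>binomial (m - 1) q\<close> wedge summands of dimension \<open>3 + q\<close>. The count
  follows from \<open>(k - 1) binomial (m + 1) k = (k - 1) binomial m k + m binomial (m - 1) (k - 2)\<close>.
\<close>

section \<open>Homotopies\<close>

text \<open>Why one circle factor splits: cut the circle at the point where its end points are
  identified. The cells over the cut form a family over \<open>T\<close>, and the rest is a family
  over \<open>T\<close> in which the circle has become one more cell coordinate. The attaching map
  of the rest runs over two copies of a cut cell with opposite orientations, and along the old
  attaching map in between. Once the latter is contracted the two copies cancel, so the rest is
  null-homotopic as well and the splitting can be iterated. This forces two features on the
  statements: null homotopies must respect the circle identifications, since otherwise they would
  not descend to families over the torus, and equivalences must be based, since the contracted parts
  are sewn together at the base point. A family starts with 3 cell coordinates (two from a disc, one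
  from the open circle); opening \<open>q\<close> of the \<open>m - 1\<close> circles gives the
  binomial coefficient. All models are subsets of function types with a fixed value in the spare
  coordinates, so that their inclusions are plain set inclusions.\<close>

lemma homotopic_with_canonI:
  fixes h :: "real \<Rightarrow> 'a::topological_space \<Rightarrow> 'b::topological_space"
  assumes "continuous_on ({0..1} \<times> S) (\<lambda>y. h (fst y) (snd y))"
    and "\<And>t x. \<lbrakk>0 \<le> t; t \<le> 1; x \<in> S\<rbrakk> \<Longrightarrow> h t x \<in> T"
    and "\<And>x. x \<in> S \<Longrightarrow> h 0 x = f x" "\<And>x. x \<in> S \<Longrightarrow> h 1 x = g x"
    and "\<And>t. \<lbrakk>0 \<le> t; t \<le> 1\<rbrakk> \<Longrightarrow> P (h t)"
    and P: "\<And>h k. (\<And>x. x \<in> S \<Longrightarrow> h x = k x) \<Longrightarrow> P h \<longleftrightarrow> P k"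
  shows "homotopic_with_canon P S T f g"
proof -
  let ?h = "\<lambda>y. h (fst y) (snd y)"
  have c: "continuous_map (prod_topology (top_of_set {0..1::real}) (top_of_set S)) (top_of_set T) ?h"
    using assms(1,2) by (simp add: Pi_iff)
  have P': "\<And>h k. (\<And>x. x \<in> topspace (top_of_set S) \<Longrightarrow> h x = k x) \<Longrightarrow> P h \<longleftrightarrow> P k"
    by (rule P) simp
  show ?thesis
    by (rule iffD2[OF homotopic_with], erule P') (intro exI[of _ ?h] conjI c; use assms(3-5) in simp)
qed

lemma homotopic_with_canonE:
  fixes f :: "'a::topological_space \<Rightarrow> 'b::topological_space"
  assumes "homotopic_with_canon P S T f g"
  obtains h :: "real \<Rightarrow> 'a \<Rightarrow> 'b" where "continuous_on ({0..1} \<times> S) (\<lambda>y. h (fst y) (snd y))"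
    "\<And>t x. \<lbrakk>0 \<le> t; t \<le> 1; x \<in> S\<rbrakk> \<Longrightarrow> h t x \<in> T"
    "\<And>x. h 0 x = f x" "\<And>x. h 1 x = g x"
    "\<And>t. \<lbrakk>0 \<le> t; t \<le> 1\<rbrakk> \<Longrightarrow> P (h t)"
proof -
  obtain k where k: "continuous_map (prod_topology (top_of_set {0..1::real}) (top_of_set S)) (top_of_set T) k"
    "\<forall>x. k (0, x) = f x" "\<forall>x. k (1, x) = g x" "\<forall>t\<in>{0..1}. P (\<lambda>x. k (t, x))"
    using assms unfolding homotopic_with_def by blast
  have "continuous_on ({0..1} \<times> S) k" "k \<in> ({0..1} \<times> S) \<rightarrow> T"
    using k(1) unfolding prod_topology_subtopology_eu continuous_map_subtopology_eu by blast+
  then show ?thesis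
    by (intro that[of "\<lambda>t x. k (t, x)"]) (use k(2-4) in \<open>simp_all add: Pi_iff\<close>)
qed

lemma continuous_on_curried_compose:
  assumes "continuous_on (I \<times> S) (\<lambda>y. h (fst y) (snd y))"
    and "continuous_on U p" "continuous_on U q" "\<And>u. u \<in> U \<Longrightarrow> p u \<in> I" "\<And>u. u \<in> U \<Longrightarrow> q u \<in> S"
  shows "continuous_on U (\<lambda>u. h (p u) (q u))"
proof -
  have "continuous_on U ((\<lambda>y. h (fst y) (snd y)) \<circ> (\<lambda>u. (p u, q u)))"
    by (rule continuous_on_compose) (use assms in \<open>auto intro!: continuous_intros intro: continuous_on_subset\<close>)
  then show ?thesis by (simp add: o_def)
qed

section \<open>Cubes\<close>

text \<open>With the maximum norm the cell on \<open>insert j K\<close> is the product of the cell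
  on \<open>K\<close> with an interval, which is what turning a circle coordinate into a cell
  coordinate requires. The inserted 0 keeps \<open>Max\<close> meaningful for
  \<open>K = {}\<close>.\<close>

definition cell_norm :: "nat set \<Rightarrow> (nat \<Rightarrow> real) \<Rightarrow> real" where
  "cell_norm K x = Max (insert 0 ((\<lambda>i. \<bar>x i\<bar>) ` K))"

definition cube :: "nat set \<Rightarrow> (nat \<Rightarrow> real) set" where
  "cube Q = {x. (\<forall>i\<in>Q. \<bar>x i\<bar> \<le> 1) \<and> (\<forall>i. i \<notin> Q \<longrightarrow> x i = 0)}"

definition scale_on :: "nat set \<Rightarrow> real \<Rightarrow> (nat \<Rightarrow> real) \<Rightarrow> nat \<Rightarrow> real" where
  "scale_on K c x = (\<lambda>i. if i \<in> K then c * x i else x i)"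

lemma cell_norm_insert: "finite K \<Longrightarrow> cell_norm (insert i K) x = max \<bar>x i\<bar> (cell_norm K x)"
  by (simp add: cell_norm_def insert_commute[of 0])

lemma cell_norm_nonneg [simp]: "finite K \<Longrightarrow> 0 \<le> cell_norm K x"
  by (simp add: cell_norm_def)

lemma cell_norm_le_iff: "finite K \<Longrightarrow> 0 \<le> c \<Longrightarrow> cell_norm K x \<le> c \<longleftrightarrow> (\<forall>i\<in>K. \<bar>x i\<bar> \<le> c)"
  by (simp add: cell_norm_def)

lemma abs_le_cell_norm: "finite K \<Longrightarrow> i \<in> K \<Longrightarrow> \<bar>x i\<bar> \<le> cell_norm K x"
  by (simp add: cell_norm_def)

lemma cell_norm_scale_on: "finite K \<Longrightarrow> cell_norm K (scale_on K c x) = \<bar>c\<bar> * cell_norm K x"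
proof (induction K rule: finite_induct)
  case empty
  then show ?case by (simp add: cell_norm_def)
next
  case (insert i K)
  have "cell_norm K (scale_on (insert i K) c x) = cell_norm K (scale_on K c x)"
    unfolding cell_norm_def by (intro arg_cong[where f = Max] arg_cong[where f = "insert 0"] image_cong)
      (auto simp: scale_on_def)
  with insert show ?case
    by (simp add: cell_norm_insert) (simp add: scale_on_def abs_mult max_mult_distrib_left)
qed

lemma cell_norm_cong: "(\<And>i. i \<in> K \<Longrightarrow> x i = y i) \<Longrightarrow> cell_norm K x = cell_norm K y"
  by (simp add: cell_norm_def cong: image_cong)

lemma continuous_on_cell_norm [continuous_intros]:
  "finite K \<Longrightarrow> continuous_on S f \<Longrightarrow> continuous_on S (\<lambda>x. cell_norm K (f x))"
proof (induction K rule: finite_induct)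
  case empty
  then show ?case by (simp add: cell_norm_def)
next
  case (insert i K)
  then show ?case
    by (simp add: cell_norm_insert continuous_on_max continuous_on_rabs continuous_on_product_then_coordinatewise)
qed

lemma continuous_on_scale_on [continuous_intros]:
  assumes "continuous_on S c" "continuous_on S (\<lambda>x. f x i)"
  shows "continuous_on S (\<lambda>x. scale_on K (c x) (f x) i)"
  using assms by (cases "i \<in> K") (auto simp: scale_on_def intro!: continuous_on_mult)

lemma continuous_on_apply [continuous_intros]: "continuous_on S (\<lambda>x. x i)"
  by (rule continuous_on_product_then_coordinatewise) (rule continuous_on_id)

lemma continuous_on_snd_coordinate [continuous_intros]: "continuous_on S (\<lambda>y. snd y i)"
  by (rule continuous_on_product_then_coordinatewise) (rule continuous_on_snd[OF continuous_on_id])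

lemma continuous_on_fun_upd [continuous_intros]:
  assumes "continuous_on S g" "continuous_on S (\<lambda>x. f x j)"
  shows "continuous_on S (\<lambda>x. ((f x)(i := g x)) j)"
  using assms by (cases "j = i") auto

lemma cell_norm_eq_1_iff:
  assumes "finite K" "\<And>i. i \<in> K \<Longrightarrow> \<bar>x i\<bar> \<le> 1"
  shows "cell_norm K x = 1 \<longleftrightarrow> (\<exists>i\<in>K. \<bar>x i\<bar> = 1)"
proof
  assume 1: "cell_norm K x = 1"
  have "cell_norm K x \<in> insert 0 ((\<lambda>i. \<bar>x i\<bar>) ` K)"
    unfolding cell_norm_def using assms(1) by (intro Max_in) auto
  with 1 show "\<exists>i\<in>K. \<bar>x i\<bar> = 1" by auto
next
  assume "\<exists>i\<in>K. \<bar>x i\<bar> = 1"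
  then have "1 \<le> cell_norm K x"
    using abs_le_cell_norm[OF assms(1), of _ x] by fastforce
  moreover have "cell_norm K x \<le> 1"
    using assms by (simp add: cell_norm_le_iff)
  ultimately show "cell_norm K x = 1" by simp
qed

lemma compact_cube: "compact (cube Q)"
proof -
  have eq: "cube Q = (\<Pi>\<^sub>E i\<in>UNIV. if i \<in> Q then {-1..1} else {0})"
    by (auto simp: cube_def PiE_iff abs_le_iff split: if_splits)
  have "compactin (product_topology (\<lambda>i. euclideanreal) UNIV) (cube Q)"
    unfolding eq by (simp add: compactin_PiE)
  then show ?thesis
    by (simp add: euclidean_product_topology)
qed

section \<open>Attaching families of cells\<close>

text \<open>Coordinates in \<open>J\<close> are circle coordinates: their two end points are identified.\<close>

definition circle_equiv :: "nat set \<Rightarrow> (nat \<Rightarrow> real) \<Rightarrow> (nat \<Rightarrow> real) \<Rightarrow> bool" where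
  "circle_equiv J x y \<longleftrightarrow> (\<forall>i. x i = y i \<or> i \<in> J \<and> \<bar>x i\<bar> = 1 \<and> \<bar>y i\<bar> = 1)"

text \<open>These are the maps that descend to the torus. As side condition of
  \<open>homotopic_with_canon\<close> it makes every stage of a homotopy descend.\<close>

definition circle_invariant :: "nat set \<Rightarrow> (nat \<Rightarrow> real) set \<Rightarrow> ((nat \<Rightarrow> real) \<Rightarrow> 'a) \<Rightarrow> bool" where
  "circle_invariant J X f \<longleftrightarrow> (\<forall>x\<in>X. \<forall>y\<in>X. circle_equiv J x y \<longrightarrow> f x = f y)"

definition cell_boundary :: "nat set \<Rightarrow> nat set \<Rightarrow> (nat \<Rightarrow> real) set" where
  "cell_boundary K J = {x \<in> cube (K \<union> J). cell_norm K x = 1}"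

text \<open>A pushout described inside an ambient space: \<open>K\<close> holds the cell directions,
  \<open>J\<close> the torus parameters, and exactly the points of radius 1 are glued to
  \<open>A\<close>. Off \<open>A\<close>, the only identifications are those of the torus.\<close>

definition attached ::
    "'a::topological_space set \<Rightarrow> 'a set \<Rightarrow> nat set \<Rightarrow> nat set \<Rightarrow> ((nat \<Rightarrow> real) \<Rightarrow> 'a) \<Rightarrow> bool" where
  "attached Z A K J \<Phi> \<longleftrightarrow>
     closed A \<and> continuous_on (cube (K \<union> J)) \<Phi> \<and> Z = A \<union> \<Phi> ` cube (K \<union> J) \<and>
     (\<forall>x\<in>cube (K \<union> J). \<Phi> x \<in> A \<longleftrightarrow> cell_norm K x = 1) \<and> circle_invariant J (cube (K \<union> J)) \<Phi> \<and>
     (\<forall>x\<in>cube (K \<union> J). \<forall>y\<in>cube (K \<union> J). \<Phi> x = \<Phi> y \<longrightarrow> \<Phi> x \<notin> A \<longrightarrow> circle_equiv J x y)"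

text \<open>Base points are carried along because maps on a cell are pieced together on shells where
  they take the value \<open>a\<close>; there the equivalence and its homotopies must have
  prescribed values.\<close>

definition based_equiv :: "'a::topological_space set \<Rightarrow> 'a \<Rightarrow> 'b::topological_space set \<Rightarrow> 'b \<Rightarrow> bool" where
  "based_equiv S a T b \<longleftrightarrow> a \<in> S \<and> b \<in> T \<and> (\<exists>f g. continuous_on S f \<and> f ` S \<subseteq> T \<and> f a = b \<and>
     continuous_on T g \<and> g ` T \<subseteq> S \<and> g b = a \<and>
     homotopic_with_canon (\<lambda>k. k a = a) S S (\<lambda>x. g (f x)) (\<lambda>x. x) \<and>
     homotopic_with_canon (\<lambda>k. k b = b) T T (\<lambda>x. f (g x)) (\<lambda>x. x))"

text \<open>Radii from 1 to 2 run through the homotopy \<open>N\<close>; the \<open>min\<close>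
  freezes its end value beyond radius 2, so the map is defined at every radius and may be
  precomposed with arbitrary rescalings.\<close>

definition prolong where
  "prolong K \<Phi> N x = (if cell_norm K x \<le> 1 then \<Phi> x
     else N (min 1 (cell_norm K x - 1)) (scale_on K (1 / cell_norm K x) x))"

definition prolong_domain :: "nat set \<Rightarrow> nat set \<Rightarrow> (nat \<Rightarrow> real) set" where
  "prolong_domain K J = {x. (\<forall>i\<in>J. \<bar>x i\<bar> \<le> 1) \<and> (\<forall>i. i \<notin> K \<union> J \<longrightarrow> x i = 0)}"

section \<open>Prolonging a characteristic map along a homotopy of its boundary values\<close>

lemma prolong_domain_in_cube: "finite K \<Longrightarrow> x \<in> prolong_domain K J \<Longrightarrow> cell_norm K x \<le> 1 \<Longrightarrow> x \<in> cube (K \<union> J)"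
  by (auto simp: prolong_domain_def cube_def cell_norm_le_iff)

lemma prolong_domain_normalize:
  assumes "finite K" "K \<inter> J = {}" "x \<in> prolong_domain K J" "1 \<le> cell_norm K x"
  shows "scale_on K (1 / cell_norm K x) x \<in> cell_boundary K J"
proof -
  have n: "cell_norm K (scale_on K (1 / cell_norm K x) x) = 1"
    using assms by (simp add: cell_norm_scale_on)
  have "scale_on K (1 / cell_norm K x) x \<in> prolong_domain K J"
    using assms(2,3) by (auto simp: prolong_domain_def scale_on_def)
  with n show ?thesis
    using assms(1) by (auto simp: cell_boundary_def intro!: prolong_domain_in_cube)
qed

lemma continuous_on_prolong:
  assumes "finite K" "K \<inter> J = {}" and \<Phi>: "continuous_on (cube (K \<union> J)) \<Phi>"
    and N: "continuous_on ({0..1} \<times> cell_boundary K J) (\<lambda>y. N (fst y) (snd y))"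
    and N0: "\<And>x. x \<in> cell_boundary K J \<Longrightarrow> N 0 x = \<Phi> x"
  shows "continuous_on (prolong_domain K J) (prolong K \<Phi> N)"
  unfolding prolong_def
proof (rule continuous_on_cases_le)
  show "continuous_on {x \<in> prolong_domain K J. cell_norm K x \<le> 1} \<Phi>"
    using assms(1) by (auto intro: continuous_on_subset[OF \<Phi>] prolong_domain_in_cube)
  show "continuous_on {x \<in> prolong_domain K J. 1 \<le> cell_norm K x}
          (\<lambda>x. N (min 1 (cell_norm K x - 1)) (scale_on K (1 / cell_norm K x) x))"
    by (rule continuous_on_curried_compose[OF N])
       (use assms(1,2) in \<open>auto intro!: continuous_intros prolong_domain_normalize\<close>)
  show "continuous_on (prolong_domain K J) (cell_norm K)"
    using assms(1) by (intro continuous_intros) auto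
next
  fix x assume x: "x \<in> prolong_domain K J" "cell_norm K x = 1"
  then have "x \<in> cell_boundary K J"
    using assms(1) by (auto simp: cell_boundary_def intro: prolong_domain_in_cube)
  moreover have "scale_on K 1 x = x" by (auto simp: scale_on_def)
  ultimately show "\<Phi> x = N (min 1 (cell_norm K x - 1)) (scale_on K (1 / cell_norm K x) x)"
    using x N0 by simp
qed

section \<open>Maps and homotopies defined separately on \<open>A\<close> and on a cell\<close>

lemma Hausdorff_space_euclidean_t2: "Hausdorff_space (euclidean :: 'a::t2_space topology)"
  unfolding Hausdorff_space_def disjnt_def by (simp add: separation_t2)

text \<open>The cell is compact and the space Hausdorff, so \<open>A\<close> and the cell carry the final topology.\<close>

lemma continuous_on_paste:
  fixes \<Phi> :: "'c::topological_space \<Rightarrow> 'a::t2_space" and f :: "'a \<Rightarrow> 'b::topological_space"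
  assumes "closed A" "compact Q" "continuous_on Q \<Phi>" "continuous_on A f" "continuous_on Q (\<lambda>v. f (\<Phi> v))"
  shows "continuous_on (A \<union> \<Phi> ` Q) f"
proof (rule continuous_on_closed_Un)
  show "closed (\<Phi> ` Q)"
    using assms(2,3) compact_continuous_image compact_imp_closed by blast
  have q: "quotient_map (top_of_set Q) (top_of_set (\<Phi> ` Q)) \<Phi>"
    by (rule continuous_imp_quotient_map) (use assms in \<open>auto simp: compact_space_subtopology intro: Hausdorff_space_subtopology Hausdorff_space_euclidean_t2\<close>)
  have "continuous_map (top_of_set Q) euclidean (f \<circ> \<Phi>)"
    using assms(5) by (simp add: o_def)
  then have "continuous_map (top_of_set (\<Phi> ` Q)) euclidean f"
    using continuous_compose_quotient_map[OF q] by blast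
  then show "continuous_on (\<Phi> ` Q) f" by simp
qed (use assms in auto)

text \<open>Multiplying with the compact interval keeps the cell compact and \<open>A\<close>
  closed, so pasting applies to the map that sends \<open>(t, v)\<close> to
  \<open>(t, \<Phi> v)\<close>.\<close>

lemma continuous_on_paste_homotopy:
  fixes \<Phi> :: "'c::topological_space \<Rightarrow> 'a::t2_space" and h :: "real \<Rightarrow> 'a \<Rightarrow> 'b::topological_space"
  assumes "closed A" "compact Q" "continuous_on Q \<Phi>"
    "continuous_on ({0..1} \<times> A) (\<lambda>y. h (fst y) (snd y))"
    "continuous_on ({0..1} \<times> Q) (\<lambda>y. h (fst y) (\<Phi> (snd y)))"
  shows "continuous_on ({0..1} \<times> (A \<union> \<Phi> ` Q)) (\<lambda>y. h (fst y) (snd y))"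
proof -
  let ?\<Phi> = "\<lambda>y::real \<times> 'c. (fst y, \<Phi> (snd y))"
  have c: "continuous_on ({0..1} \<times> Q) ?\<Phi>"
    by (intro continuous_intros continuous_on_compose2[OF assms(3)]) auto
  have "continuous_on ({0..1} \<times> A \<union> ?\<Phi> ` ({0..1} \<times> Q)) (\<lambda>y. h (fst y) (snd y))"
    by (rule continuous_on_paste) (use assms c in \<open>auto simp: closed_Times compact_Times\<close>)
  moreover have "{0..1} \<times> A \<union> ?\<Phi> ` ({0..1} \<times> Q) = {0..1} \<times> (A \<union> \<Phi> ` Q)"
    by force
  ultimately show ?thesis by simp
qed

lemma scale_on_scale_on [simp]: "scale_on K c (scale_on K d x) = scale_on K (c * d) x"
  by (auto simp: scale_on_def)

lemma scale_on_1 [simp]: "scale_on K 1 x = x"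
  by (auto simp: scale_on_def)

lemma scale_on_prolong_domain: "K \<inter> J = {} \<Longrightarrow> x \<in> prolong_domain K J \<Longrightarrow> scale_on K c x \<in> prolong_domain K J"
  by (auto simp: prolong_domain_def scale_on_def)

lemma cube_iff: "finite K \<Longrightarrow> K \<inter> J = {} \<Longrightarrow> x \<in> cube (K \<union> J) \<longleftrightarrow> x \<in> prolong_domain K J \<and> cell_norm K x \<le> 1"
  by (auto simp: prolong_domain_def cube_def cell_norm_le_iff)

lemma prolong_mem:
  assumes "finite K" "K \<inter> J = {}" "x \<in> prolong_domain K J"
    and N: "\<And>t x. \<lbrakk>0 \<le> t; t \<le> 1; x \<in> cell_boundary K J\<rbrakk> \<Longrightarrow> N t x \<in> A" "\<And>x. x \<in> cell_boundary K J \<Longrightarrow> N 0 x = \<Phi> x"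
    and "1 \<le> cell_norm K x"
  shows "prolong K \<Phi> N x \<in> A"
proof (cases "cell_norm K x \<le> 1")
  case True
  then have "x \<in> cell_boundary K J" using assms by (auto simp: cell_boundary_def cube_iff)
  then show ?thesis using True N(1)[of 0 x] N(2)[of x] by (auto simp: prolong_def)
next
  case False
  then show ?thesis
    using assms by (auto simp: prolong_def intro!: N(1) prolong_domain_normalize)
qed

lemma prolong_2:
  assumes "finite K" "K \<inter> J = {}" "x \<in> prolong_domain K J"
    and N: "\<And>x. x \<in> cell_boundary K J \<Longrightarrow> N 1 x = a"
    and "2 \<le> cell_norm K x"
  shows "prolong K \<Phi> N x = a"
  using assms by (auto simp: prolong_def intro!: N(1) prolong_domain_normalize)

text \<open>For \<open>J = {}\<close> the characteristic map is injective off \<open>A\<close>, so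
  \<open>inv_into\<close> recovers the cell point there; where \<open>\<Phi> v\<close> lies in
  \<open>A\<close>, the hypothesis \<open>eq\<close> makes the two prescriptions agree.\<close>

lemma attached_extend_homotopy:
  fixes \<Phi> :: "(nat \<Rightarrow> real) \<Rightarrow> 'a::t2_space" and u :: "real \<Rightarrow> 'a \<Rightarrow> 'b::topological_space"
  assumes att: "attached Z A K {} \<Phi>"
    and u: "continuous_on ({0..1} \<times> A) (\<lambda>y. u (fst y) (snd y))"
    and w: "continuous_on ({0..1} \<times> cube K) (\<lambda>y. w (fst y) (snd y))"
    and eq: "\<And>t v. \<lbrakk>0 \<le> t; t \<le> 1; v \<in> cube K; cell_norm K v = 1\<rbrakk> \<Longrightarrow> w t v = u t (\<Phi> v)"
  obtains h where "continuous_on ({0..1} \<times> Z) (\<lambda>y. h (fst y) (snd y))"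
    "\<And>t x. x \<in> A \<Longrightarrow> h t x = u t x"
    "\<And>t v. \<lbrakk>0 \<le> t; t \<le> 1; v \<in> cube K\<rbrakk> \<Longrightarrow> h t (\<Phi> v) = w t v"
proof -
  define h where "h t x = (if x \<in> A then u t x else w t (inv_into (cube K) \<Phi> x))" for t x
  have hA: "h t x = u t x" if "x \<in> A" for t x
    using that by (simp add: h_def)
  have h\<Phi>: "h t (\<Phi> v) = w t v" if "0 \<le> t" "t \<le> 1" "v \<in> cube K" for t v
  proof (cases "\<Phi> v \<in> A")
    case True
    then show ?thesis using that att eq by (simp add: h_def attached_def)
  next
    case False
    let ?v = "inv_into (cube K) \<Phi> (\<Phi> v)"
    have "?v \<in> cube K" "\<Phi> ?v = \<Phi> v"
      using inv_into_into[of "\<Phi> v" \<Phi> "cube K"] f_inv_into_f[of "\<Phi> v" \<Phi> "cube K"] that(3) by auto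
    then have "circle_equiv {} ?v v"
      using att False that(3) by (auto simp: attached_def)
    then have "?v = v" by (auto simp: circle_equiv_def)
    then show ?thesis using False by (simp add: h_def)
  qed
  have Z: "Z = A \<union> \<Phi> ` cube K" and cl: "closed A" and c\<Phi>: "continuous_on (cube K) \<Phi>"
    using att by (auto simp: attached_def)
  have "continuous_on ({0..1} \<times> Z) (\<lambda>y. h (fst y) (snd y))"
    unfolding Z
  proof (rule continuous_on_paste_homotopy[OF cl compact_cube c\<Phi>])
    show "continuous_on ({0..1} \<times> A) (\<lambda>y. h (fst y) (snd y))"
      using u by (rule continuous_on_eq) (auto simp: hA)
    show "continuous_on ({0..1} \<times> cube K) (\<lambda>y. h (fst y) (\<Phi> (snd y)))"
      using w by (rule continuous_on_eq) (auto simp: h\<Phi>)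
  qed
  then show ?thesis using hA h\<Phi> that by blast
qed

lemma attached_extend:
  fixes \<Phi> :: "(nat \<Rightarrow> real) \<Rightarrow> 'a::t2_space" and u :: "'a \<Rightarrow> 'b::topological_space"
  assumes att: "attached Z A K {} \<Phi>"
    and u: "continuous_on A u" and w: "continuous_on (cube K) w"
    and eq: "\<And>v. \<lbrakk>v \<in> cube K; cell_norm K v = 1\<rbrakk> \<Longrightarrow> w v = u (\<Phi> v)"
  obtains F where "continuous_on Z F" "\<And>x. x \<in> A \<Longrightarrow> F x = u x"
    "\<And>v. v \<in> cube K \<Longrightarrow> F (\<Phi> v) = w v"
proof -
  have u': "continuous_on ({0..1} \<times> A) (\<lambda>y. (\<lambda>_::real. u) (fst y) (snd y))"
    by (rule continuous_on_compose2[OF u]) (auto intro: continuous_intros)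
  have w': "continuous_on ({0..1} \<times> cube K) (\<lambda>y. (\<lambda>_::real. w) (fst y) (snd y))"
    by (rule continuous_on_compose2[OF w]) (auto intro: continuous_intros)
  obtain h where h: "continuous_on ({0..1} \<times> Z) (\<lambda>y. h (fst y) (snd y))"
    "\<And>t x. x \<in> A \<Longrightarrow> h t x = u x"
    "\<And>t v. \<lbrakk>0 \<le> t; t \<le> 1; v \<in> cube K\<rbrakk> \<Longrightarrow> h (t::real) (\<Phi> v) = w v"
    by (rule attached_extend_homotopy[OF att, where u = "\<lambda>_. u" and w = "\<lambda>_. w"]) (use u' w' eq in auto)
  have "continuous_on Z (\<lambda>x. h 0 x)"
    by (rule continuous_on_curried_compose[OF h(1)]) (auto intro: continuous_intros)
  then show ?thesis using h(2,3) by (intro that[of "h 0"]) auto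
qed

lemma attached_homotopy:
  fixes \<Phi> :: "(nat \<Rightarrow> real) \<Rightarrow> 'a::t2_space" and u :: "real \<Rightarrow> 'a \<Rightarrow> 'b::topological_space"
  assumes att: "attached Z A K {} \<Phi>"
    and u: "continuous_on ({0..1} \<times> A) (\<lambda>y. u (fst y) (snd y))"
    and w: "continuous_on ({0..1} \<times> cube K) (\<lambda>y. w (fst y) (snd y))"
    and eq: "\<And>t v. \<lbrakk>0 \<le> t; t \<le> 1; v \<in> cube K; cell_norm K v = 1\<rbrakk> \<Longrightarrow> w t v = u t (\<Phi> v)"
    and uT: "\<And>t x. \<lbrakk>0 \<le> t; t \<le> 1; x \<in> A\<rbrakk> \<Longrightarrow> u t x \<in> T"
    and wT: "\<And>t v. \<lbrakk>0 \<le> t; t \<le> 1; v \<in> cube K\<rbrakk> \<Longrightarrow> w t v \<in> T"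
    and p: "\<And>x. x \<in> A \<Longrightarrow> p x = u 0 x" "\<And>v. v \<in> cube K \<Longrightarrow> p (\<Phi> v) = w 0 v"
    and q: "\<And>x. x \<in> A \<Longrightarrow> q x = u 1 x" "\<And>v. v \<in> cube K \<Longrightarrow> q (\<Phi> v) = w 1 v"
    and a: "a \<in> A" "\<And>t. \<lbrakk>0 \<le> t; t \<le> 1\<rbrakk> \<Longrightarrow> u t a = b"
  shows "homotopic_with_canon (\<lambda>k. k a = b) Z T p q"
proof -
  obtain h where h: "continuous_on ({0..1} \<times> Z) (\<lambda>y. h (fst y) (snd y))"
    "\<And>t x. x \<in> A \<Longrightarrow> h t x = u t x"
    "\<And>t v. \<lbrakk>0 \<le> t; t \<le> 1; v \<in> cube K\<rbrakk> \<Longrightarrow> h t (\<Phi> v) = w t v"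
    using attached_extend_homotopy[OF att u w eq] by blast
  have Z: "Z = A \<union> \<Phi> ` cube K" using att by (auto simp: attached_def)
  show ?thesis
  proof (rule homotopic_with_canonI[OF h(1)])
    show "h t x \<in> T" if "0 \<le> t" "t \<le> 1" "x \<in> Z" for t x
      using that h(2,3) uT wT by (auto simp: Z)
    show "h 0 x = p x" if "x \<in> Z" for x
      using that h(2,3) p by (auto simp: Z)
    show "h 1 x = q x" if "x \<in> Z" for x
      using that h(2,3) q by (auto simp: Z)
    show "h t a = b" if "0 \<le> t" "t \<le> 1" for t
      using that h(2) a by auto
    show "(h a = b) = (k a = b)" if "\<And>x. x \<in> Z \<Longrightarrow> h x = k x" for h k
      using that[of a] a(1) by (auto simp: Z)
  qed
qed

text \<open>
  On the cell, \<open>e\<close> prolongs the characteristic map by the null homotopy on the shell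
  \<open>1 \<le> cell_norm K v \<le> 2\<close>. The inverse equivalence is \<open>v \<mapsto> e (2 v)\<close>; all homotopies below only
  change the radial coordinate.
\<close>

theorem based_equiv_attached_cell:
  fixes Z :: "'a::t2_space set" and Z' :: "'b::t2_space set"
  assumes K: "finite K"
    and att: "attached Z A K {} \<Phi>" and att': "attached Z' A' K {} \<Phi>'"
    and null: "homotopic_with_canon (\<lambda>_. True) (cell_boundary K {}) A \<Phi> (\<lambda>_. a)"
    and const: "\<And>x. x \<in> cell_boundary K {} \<Longrightarrow> \<Phi>' x = a'"
    and based_equiv: "based_equiv A a A' a'"
  shows "based_equiv Z a Z' a'"
proof -
  obtain f g where f: "continuous_on A f" "f ` A \<subseteq> A'" "f a = a'"
    and g: "continuous_on A' g" "g ` A' \<subseteq> A" "g a' = a"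
    and gf: "homotopic_with_canon (\<lambda>k. k a = a) A A (\<lambda>x. g (f x)) (\<lambda>x. x)"
    and fg: "homotopic_with_canon (\<lambda>k. k a' = a') A' A' (\<lambda>x. f (g x)) (\<lambda>x. x)"
    and a: "a \<in> A" "a' \<in> A'"
    using based_equiv unfolding based_equiv_def by blast
  obtain h :: "real \<Rightarrow> 'a \<Rightarrow> 'a" where h: "continuous_on ({0..1} \<times> A) (\<lambda>y. h (fst y) (snd y))"
      "\<And>t x. \<lbrakk>0 \<le> t; t \<le> 1; x \<in> A\<rbrakk> \<Longrightarrow> h t x \<in> A"
      "\<And>x. h 0 x = g (f x)" "\<And>x. h 1 x = x" "\<And>t. \<lbrakk>0 \<le> t; t \<le> 1\<rbrakk> \<Longrightarrow> h t a = a"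
    using homotopic_with_canonE[OF gf] by blast
  obtain k :: "real \<Rightarrow> 'b \<Rightarrow> 'b" where k: "continuous_on ({0..1} \<times> A') (\<lambda>y. k (fst y) (snd y))"
      "\<And>t x. \<lbrakk>0 \<le> t; t \<le> 1; x \<in> A'\<rbrakk> \<Longrightarrow> k t x \<in> A'"
      "\<And>x. k 0 x = f (g x)" "\<And>x. k 1 x = x" "\<And>t. \<lbrakk>0 \<le> t; t \<le> 1\<rbrakk> \<Longrightarrow> k t a' = a'"
    using homotopic_with_canonE[OF fg] by blast
  obtain N :: "real \<Rightarrow> (nat \<Rightarrow> real) \<Rightarrow> 'a" where N: "continuous_on ({0..1} \<times> cell_boundary K {}) (\<lambda>y. N (fst y) (snd y))"
      "\<And>t x. \<lbrakk>0 \<le> t; t \<le> 1; x \<in> cell_boundary K {}\<rbrakk> \<Longrightarrow> N t x \<in> A"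
      "\<And>x. N 0 x = \<Phi> x" "\<And>x. N 1 x = a"
    by (rule homotopic_with_canonE[OF null]) blast
  define E where "E = prolong_domain K {}"
  define e where "e = prolong K \<Phi> N"
  define e' where "e' = prolong K \<Phi>' (\<lambda>_ _. a')"
  let ?C = "cube K" and ?r = "cell_norm K" and ?s = "scale_on K"
  have \<Phi>: "continuous_on ?C \<Phi>" and Z: "Z = A \<union> \<Phi> ` ?C"
    and \<Phi>A: "\<And>x. x \<in> ?C \<Longrightarrow> \<Phi> x \<in> A \<longleftrightarrow> ?r x = 1"
    using att by (auto simp: attached_def)
  have \<Phi>': "continuous_on ?C \<Phi>'" and Z': "Z' = A' \<union> \<Phi>' ` ?C"
    using att' by (auto simp: attached_def)
  have CE: "x \<in> ?C \<longleftrightarrow> x \<in> E \<and> ?r x \<le> 1" for x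
    using cube_iff[OF K, of "{}"] by (simp add: E_def)
  have cell_boundary: "cell_boundary K {} = {x \<in> ?C. ?r x = 1}" by (simp add: cell_boundary_def)
  have sE: "?s c x \<in> E" if "x \<in> E" for c x
    using that by (simp add: E_def scale_on_prolong_domain)
  have rs: "?r (?s c x) = \<bar>c\<bar> * ?r x" for c x
    using K by (rule cell_norm_scale_on)
  have e: "continuous_on E e"
    unfolding E_def e_def using \<Phi> N K by (intro continuous_on_prolong) auto
  have e\<Phi>: "e x = \<Phi> x" if "x \<in> ?C" for x
    using that by (simp add: e_def prolong_def CE)
  have eA: "e x \<in> A" if "x \<in> E" "1 \<le> ?r x" for x
    using that K N unfolding E_def e_def by (intro prolong_mem[where J = "{}"]) auto
  have ea: "e x = a" if "x \<in> E" "2 \<le> ?r x" for x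
    using that K N unfolding E_def e_def by (intro prolong_2[where J = "{}"]) auto
  have eZ: "e x \<in> Z" if "x \<in> E" for x
  proof (cases "?r x \<le> 1")
    case True
    then show ?thesis using that e\<Phi>[of x] by (auto simp: Z CE)
  next
    case False
    then show ?thesis using that eA[of x] by (auto simp: Z)
  qed
  have e': "continuous_on E e'"
    unfolding E_def e'_def using \<Phi>' const K by (intro continuous_on_prolong) auto
  have e'\<Phi>: "e' x = \<Phi>' x" if "x \<in> ?C" for x
    using that by (simp add: e'_def prolong_def CE)
  have e'a: "e' x = a'" if "x \<in> E" "1 \<le> ?r x" for x
    using that const[of x] by (cases "?r x = 1") (auto simp: e'_def prolong_def CE cell_boundary)
  have e'Z: "e' x \<in> Z'" if "x \<in> E" for x
  proof (cases "?r x \<le> 1")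
    case True
    then show ?thesis using that e'\<Phi>[of x] by (auto simp: Z' CE)
  next
    case False
    then show ?thesis using that e'a[of x] a by (auto simp: Z')
  qed
  note cont = continuous_on_compose2[OF e] continuous_on_compose2[OF e'] continuous_on_compose2[OF \<Phi>]
    continuous_on_compose2[OF \<Phi>'] continuous_on_compose2[OF f(1)] continuous_on_compose2[OF g(1)]
  have r1: "\<bar>3 / r - 2\<bar> * r = 3 - 2 * r" if "1/2 \<le> r" "r \<le> 1" for r :: real
    using that by (simp add: abs_if field_simps)
  \<comment> \<open>The inner half covers the new cell by doubling. On the outer half the scaled
    point has radius \<open>3 - 2 * r\<close>, which falls from 2 to 1: the null homotopy is run
    backwards, from \<open>a\<close> at \<open>r = 1/2\<close> (where \<open>\<Phi>'\<close> also
    gives \<open>a'\<close>) to \<open>\<Phi> v\<close> at \<open>r = 1\<close>.\<close>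
  define Fc where "Fc v = (if ?r v \<le> 1/2 then \<Phi>' (?s 2 v) else f (e (?s (3 / ?r v - 2) v)))" for v
  have Fc: "continuous_on ?C Fc"
    unfolding Fc_def
  proof (rule continuous_on_cases_le)
    show "continuous_on {v \<in> ?C. ?r v \<le> 1/2} (\<lambda>v. \<Phi>' (?s 2 v))"
      by (intro cont continuous_intros) (auto simp: CE rs sE)
    show "continuous_on {v \<in> ?C. 1/2 \<le> ?r v} (\<lambda>v. f (e (?s (3 / ?r v - 2) v)))"
      by (intro cont continuous_intros K) (auto simp: CE rs sE r1 intro!: eA)
    show "continuous_on ?C ?r" by (intro continuous_intros K)
    show "\<Phi>' (?s 2 v) = f (e (?s (3 / ?r v - 2) v))" if "v \<in> ?C" "?r v = 1/2" for v
    proof -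
      have "3 / ?r v - 2 = 4" unfolding that(2) by simp
      then show ?thesis
        using that(1) ea[of "?s 4 v"] const[of "?s 2 v"] f(3) by (simp add: CE rs sE cell_boundary that(2))
    qed
  qed
  obtain F where F: "continuous_on Z F" "\<And>x. x \<in> A \<Longrightarrow> F x = f x"
    "\<And>v. v \<in> ?C \<Longrightarrow> F (\<Phi> v) = Fc v"
    using attached_extend[OF att f(1) Fc] e\<Phi> by (auto simp: Fc_def)
  obtain G where G: "continuous_on Z' G" "\<And>x. x \<in> A' \<Longrightarrow> G x = g x"
    "\<And>v. v \<in> ?C \<Longrightarrow> G (\<Phi>' v) = e (?s 2 v)"
  proof (rule attached_extend[OF att' g(1)])
    show "continuous_on ?C (\<lambda>v. e (?s 2 v))"
      by (intro cont continuous_intros) (auto simp: CE sE)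
    show "e (?s 2 v) = g (\<Phi>' v)" if "v \<in> ?C" "?r v = 1" for v
      using that ea[of "?s 2 v"] const[of v] g by (simp add: CE sE rs cell_boundary)
  qed blast
  have "Fc v \<in> Z'" if v: "v \<in> ?C" for v
  proof (cases "?r v \<le> 1/2")
    case True
    then show ?thesis using v by (auto simp: Fc_def Z' CE sE rs)
  next
    case False
    then have "e (?s (3 / ?r v - 2) v) \<in> A"
      using v by (intro eA) (auto simp: CE sE rs r1)
    then show ?thesis using False f(2) by (auto simp: Fc_def Z')
  qed
  then have FZ: "F ` Z \<subseteq> Z'"
    using F(2,3) f(2) by (auto simp: Z) (auto simp: Z')
  have GZ: "G ` Z' \<subseteq> Z"
    using G(2,3) g(2) eZ by (auto simp: Z' CE sE) (auto simp: Z)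
  have GF: "homotopic_with_canon (\<lambda>k. k a = a) Z Z (\<lambda>x. G (F x)) (\<lambda>x. x)"
  proof -
    \<comment> \<open>At \<open>t = 0\<close> this is \<open>G\<close> after \<open>F\<close>. The
      value at \<open>r = 1/2\<close> is \<open>a\<close>, which \<open>h\<close> fixes, so the
      outer shell can be moved by \<open>h\<close> while the inner half stays still.\<close>
    define w where "w t v = (if ?r v \<le> 1/2 then e (?s 4 v) else h t (e (?s (3 / ?r v - 2) v)))" for t v
    have w: "continuous_on ({0..1} \<times> ?C) (\<lambda>y. w (fst y) (snd y))"
      unfolding w_def
    proof (rule continuous_on_cases_le)
      show "continuous_on {y \<in> {0..1} \<times> ?C. ?r (snd y) \<le> 1/2} (\<lambda>y. e (?s 4 (snd y)))"
        by (intro cont continuous_intros) (auto simp: CE sE)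
      show "continuous_on {y \<in> {0..1} \<times> ?C. 1/2 \<le> ?r (snd y)}
          (\<lambda>y. h (fst y) (e (?s (3 / ?r (snd y) - 2) (snd y))))"
        by (rule continuous_on_curried_compose[OF h(1)]; (intro cont continuous_intros K)?)
           (auto simp: CE rs sE r1 intro!: eA)
      show "continuous_on ({0..1} \<times> ?C) (\<lambda>y. ?r (snd y))" by (intro continuous_intros K)
      show "e (?s 4 (snd y)) = h (fst y) (e (?s (3 / ?r (snd y) - 2) (snd y)))"
        if "y \<in> {0..1} \<times> ?C" "?r (snd y) = 1/2" for y
      proof -
        have *: "3 / ?r (snd y) - 2 = 4" unfolding that(2) by simp
        show ?thesis
          unfolding * using that ea[of "?s 4 (snd y)"] h(5)[of "fst y"] by (auto simp: CE rs sE)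
      qed
    qed
    have w1: "continuous_on ?C (w 1)"
      by (rule continuous_on_curried_compose[OF w]) (auto intro: continuous_intros)
    have wb: "w t v = h t (\<Phi> v)" if "v \<in> ?C" "?r v = 1" for t v
      using that e\<Phi> by (simp add: w_def)
    obtain Q where Q: "continuous_on Z Q" "\<And>x. x \<in> A \<Longrightarrow> Q x = x"
      "\<And>v. v \<in> ?C \<Longrightarrow> Q (\<Phi> v) = w 1 v"
      using attached_extend[OF att continuous_on_id w1] wb h(4) by auto
    \<comment> \<open>What is left is \<open>e\<close> after a radial stretching, by 4 inside radius
      1/2 and by \<open>3 / r - 2\<close> outside; the \<open>max\<close> joins both cases. The
      factor is interpolated to 1, and it is 1 throughout at \<open>r = 1\<close>, so the boundary
      does not move.\<close>
    define w' where "w' t v = e (?s ((1 - t) * (3 / max (?r v) (1/2) - 2) + t) v)" for t v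
    have "homotopic_with_canon (\<lambda>k. k a = a) Z Z (\<lambda>x. G (F x)) Q"
    proof (rule attached_homotopy[OF att h(1) w])
      show "w t v = h t (\<Phi> v)" if "v \<in> ?C" "?r v = 1" for t v
        using that by (rule wb)
      show "h t x \<in> Z" if "0 \<le> t" "t \<le> 1" "x \<in> A" for t x
        using that h(2) by (auto simp: Z)
      show "w t v \<in> Z" if "0 \<le> t" "t \<le> 1" "v \<in> ?C" for t v
      proof (cases "?r v \<le> 1/2")
        case True
        then show ?thesis using that by (auto simp: w_def CE sE eZ)
      next
        case False
        then have "e (?s (3 / ?r v - 2) v) \<in> A"
          using that by (intro eA) (auto simp: CE sE rs r1)
        then show ?thesis using False that h(2) by (auto simp: w_def Z)
      qed
      show "G (F x) = h 0 x" if "x \<in> A" for x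
        using that F G h f by auto
      show "G (F (\<Phi> v)) = w 0 v" if v: "v \<in> ?C" for v
      proof (cases "?r v \<le> 1/2")
        case True
        then have "?s 2 v \<in> ?C" using v by (simp add: CE sE rs)
        then show ?thesis using v True by (simp add: F(3) Fc_def G(3) w_def)
      next
        case False
        then have "e (?s (3 / ?r v - 2) v) \<in> A"
          using v by (intro eA) (auto simp: CE sE rs r1)
        then show ?thesis using False v f(2) by (auto simp: F(3) Fc_def w_def h(3) intro!: G(2))
      qed
    qed (use Q h a in auto)
    moreover have "homotopic_with_canon (\<lambda>k. k a = a) Z Z Q (\<lambda>x. x)"
    proof (rule attached_homotopy[OF att, where u = "\<lambda>_ x. x" and w = w'])
      show "continuous_on ({0..1} \<times> ?C) (\<lambda>y. w' (fst y) (snd y))"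
        unfolding w'_def by (intro cont continuous_intros K) (auto simp: CE sE)
      show "w' t v = \<Phi> v" if "v \<in> ?C" "?r v = 1" for t v
        using that e\<Phi> by (simp add: w'_def)
      show "w' t v \<in> Z" if "v \<in> ?C" for t v
        using that by (simp add: w'_def CE sE eZ)
      show "Q (\<Phi> v) = w' 0 v" if "v \<in> ?C" for v
        using that Q(3) h(4) by (auto simp: w_def w'_def max_def)
      show "\<Phi> v = w' 1 v" if "v \<in> ?C" for v
        using that e\<Phi> by (simp add: w'_def)
    qed (use Q a in \<open>auto simp: Z intro: continuous_intros\<close>)
    ultimately show ?thesis by (rule homotopic_with_trans)
  qed
  have FG: "homotopic_with_canon (\<lambda>k. k a' = a') Z' Z' (\<lambda>x. F (G x)) (\<lambda>x. x)"
  proof -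
    \<comment> \<open>At \<open>t = 0\<close> this is the stretching in \<open>F\<close> after
      \<open>G\<close>: the radius is \<open>3 - 4 * r\<close> up to \<open>r = 1/2\<close> and
      \<open>2 * r\<close> beyond, so it comes in from 2 to 1 and goes out to 2 again. The summand
      \<open>t / r\<close> raises the radius by \<open>t\<close>; at \<open>t = 1\<close> it is at
      least 2 and the whole shell sits at \<open>a\<close>.\<close>
    define \<rho> where "\<rho> t r = max (3 / r - 4) 2 + t / r" for t r :: real
    have \<rho>: "\<bar>\<rho> t r\<bar> * r = max (3 - 4 * r) (2 * r) + t" if "1/4 \<le> r" "0 \<le> t" for t r
    proof -
      have "0 \<le> \<rho> t r" using that by (auto simp: \<rho>_def)
      moreover have "\<rho> t r * r = max (3 - 4 * r) (2 * r) + t"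
        using that by (auto simp: \<rho>_def max_def field_simps)
      ultimately show ?thesis by simp
    qed
    have \<rho>1: "1 \<le> max (3 - 4 * r) (2 * r)" for r :: real by (auto simp: max_def)
    define w where "w t v = (if ?r v \<le> 1/4 then \<Phi>' (?s 4 v) else f (e (?s (\<rho> t (?r v)) v)))" for t v
    have \<rho>A: "e (?s (\<rho> t (?r v)) v) \<in> A" if "1/4 \<le> ?r v" "0 \<le> t" "v \<in> ?C" for t v
      using that \<rho>1[of "?r v"] by (intro eA) (auto simp: CE sE rs \<rho>)
    have \<rho>a: "e (?s (\<rho> t (?r v)) v) = a" if "1/4 \<le> ?r v" "0 \<le> t" "v \<in> ?C" "?r v = 1/4 \<or> ?r v = 1 \<or> t = 1" for t v
      using that \<rho>1[of "?r v"] by (intro ea) (auto simp: CE sE rs \<rho>)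
    have w: "continuous_on ({0..1} \<times> ?C) (\<lambda>y. w (fst y) (snd y))"
      unfolding w_def
    proof (rule continuous_on_cases_le)
      show "continuous_on {y \<in> {0..1} \<times> ?C. ?r (snd y) \<le> 1/4} (\<lambda>y. \<Phi>' (?s 4 (snd y)))"
        by (intro cont continuous_intros) (auto simp: CE sE rs)
      show "continuous_on {y \<in> {0..1} \<times> ?C. 1/4 \<le> ?r (snd y)}
          (\<lambda>y. f (e (?s (\<rho> (fst y) (?r (snd y))) (snd y))))"
        unfolding \<rho>_def
        by (intro cont continuous_intros K)
           (auto simp: CE sE intro!: \<rho>A[unfolded \<rho>_def CE])
      show "continuous_on ({0..1} \<times> ?C) (\<lambda>y. ?r (snd y))" by (intro continuous_intros K)
      show "\<Phi>' (?s 4 (snd y)) = f (e (?s (\<rho> (fst y) (?r (snd y))) (snd y)))"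
        if "y \<in> {0..1} \<times> ?C" "?r (snd y) = 1/4" for y
      proof -
        have "?s 4 (snd y) \<in> cell_boundary K {}" using that by (auto simp: cell_boundary CE sE rs)
        then show ?thesis using that \<rho>a[of "snd y" "fst y"] const f(3) by auto
      qed
    qed
    have w1: "continuous_on ?C (w 1)"
      by (rule continuous_on_curried_compose[OF w]) (auto intro: continuous_intros)
    have wb: "w t v = a'" if "0 \<le> t" "v \<in> ?C" "?r v = 1" for t v
      using that \<rho>a[of v t] f(3) by (simp add: w_def)
    have \<Phi>'b: "\<Phi>' v = a'" if "v \<in> ?C" "?r v = 1" for v
      using that const by (simp add: cell_boundary)
    obtain Q where Q: "continuous_on Z' Q" "\<And>x. x \<in> A' \<Longrightarrow> Q x = x"
      "\<And>v. v \<in> ?C \<Longrightarrow> Q (\<Phi>' v) = w 1 v"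
      using attached_extend[OF att' continuous_on_id w1] wb \<Phi>'b by auto
    \<comment> \<open>The remaining map is \<open>\<Phi>'\<close> after stretching by 4 inside
      radius 1/4 and constantly \<open>a'\<close> outside, that is, \<open>e'\<close> after
      stretching by 4; the factor shrinks to 1.\<close>
    define w' where "w' t v = e' (?s ((1 - t) * 4 + t) v)" for t v
    have "homotopic_with_canon (\<lambda>k. k a' = a') Z' Z' (\<lambda>x. F (G x)) Q"
    proof (rule attached_homotopy[OF att' k(1) w])
      show "w t v = k t (\<Phi>' v)" if "0 \<le> t" "t \<le> 1" "v \<in> ?C" "?r v = 1" for t v
        using that by (simp add: wb \<Phi>'b k)
      show "k t x \<in> Z'" if "0 \<le> t" "t \<le> 1" "x \<in> A'" for t x
        using that k(2) by (auto simp: Z')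
      show "w t v \<in> Z'" if "0 \<le> t" "t \<le> 1" "v \<in> ?C" for t v
      proof (cases "?r v \<le> 1/4")
        case True
        then show ?thesis using that by (auto simp: w_def Z' CE sE rs)
      next
        case False
        then show ?thesis using that \<rho>A[of v t] f(2) by (auto simp: w_def Z')
      qed
      show "F (G x) = k 0 x" if "x \<in> A'" for x
        using that F G k g by auto
      show "F (G (\<Phi>' v)) = w 0 v" if v: "v \<in> ?C" for v
      proof -
        consider "?r v \<le> 1/4" | "1/4 < ?r v" "?r v \<le> 1/2" | "1/2 < ?r v" by linarith
        then show ?thesis
        proof cases
          case 1
          then have "?s 2 v \<in> ?C" using v by (simp add: CE sE rs)
          then show ?thesis using v 1 e\<Phi> by (simp add: F(3) Fc_def G(3) w_def rs)
        next
          case 2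
          then have "?s 2 v \<in> ?C" using v by (simp add: CE sE rs)
          moreover have "(3 / (2 * ?r v) - 2) * 2 = \<rho> 0 (?r v)"
            using 2 by (simp add: \<rho>_def max_def field_simps)
          ultimately show ?thesis using v 2 e\<Phi> by (simp add: F(3) Fc_def G(3) w_def rs)
        next
          case 3
          then have "e (?s 2 v) \<in> A" using v by (intro eA) (auto simp: CE sE rs)
          moreover have "\<rho> 0 (?r v) = 2"
            using 3 by (simp add: \<rho>_def max_def field_simps)
          ultimately show ?thesis using v 3 by (simp add: F(2) G(3) w_def)
        qed
      qed
    qed (use Q k a in auto)
    moreover have "homotopic_with_canon (\<lambda>k. k a' = a') Z' Z' Q (\<lambda>x. x)"
    proof (rule attached_homotopy[OF att', where u = "\<lambda>_ x. x" and w = w'])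
      show "continuous_on ({0..1} \<times> ?C) (\<lambda>y. w' (fst y) (snd y))"
        unfolding w'_def by (intro cont continuous_intros K) (auto simp: CE sE)
      show "w' t v = \<Phi>' v" if "0 \<le> t" "t \<le> 1" "v \<in> ?C" "?r v = 1" for t v
        using that \<Phi>'b e'a[of "?s ((1 - t) * 4 + t) v"] by (simp add: w'_def CE sE rs)
      show "w' t v \<in> Z'" if "v \<in> ?C" for t v
        using that by (simp add: w'_def CE sE e'Z)
      show "Q (\<Phi>' v) = w' 0 v" if v: "v \<in> ?C" for v
      proof (cases "?r v \<le> 1/4")
        case True
        then have "?s 4 v \<in> ?C" using v by (simp add: CE sE rs)
        then show ?thesis using True v e'\<Phi> by (simp add: Q(3) w_def w'_def)
      next
        case False
        then show ?thesis using v e'a[of "?s 4 v"] \<rho>a[of v 1] f(3)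
          by (simp add: Q(3) w_def w'_def CE sE rs)
      qed
      show "\<Phi>' v = w' 1 v" if "v \<in> ?C" for v
        using that e'\<Phi> by (simp add: w'_def)
    qed (use Q a in \<open>auto simp: Z' intro: continuous_intros\<close>)
    ultimately show ?thesis by (rule homotopic_with_trans)
  qed
  show ?thesis
    unfolding based_equiv_def
    using F(1) G(1) FZ GZ GF FG F(2)[OF a(1)] G(2)[OF a(2)] f(3) g(3) a
    by (intro conjI exI[of _ F] exI[of _ G]) (auto simp: Z Z')
qed

section \<open>Splitting one circle coordinate off a family of cells\<close>

lemma circle_invariant_cong: "(\<And>x. x \<in> X \<Longrightarrow> h x = k x) \<Longrightarrow> circle_invariant J X h \<longleftrightarrow> circle_invariant J X k"
  by (simp add: circle_invariant_def)

lemma circle_equiv_outside: "circle_equiv J x y \<Longrightarrow> i \<notin> J \<Longrightarrow> x i = y i"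
  by (auto simp: circle_equiv_def)

lemma circle_equiv_mono: "circle_equiv J x y \<Longrightarrow> J \<subseteq> J' \<Longrightarrow> circle_equiv J' x y"
  by (auto simp: circle_equiv_def)

lemma circle_equiv_scale_on: "circle_equiv J x y \<Longrightarrow> K \<inter> J = {} \<Longrightarrow> circle_equiv J (scale_on K c x) (scale_on K c y)"
  unfolding circle_equiv_def scale_on_def by (metis disjoint_iff)

lemma circle_equiv_cell_norm: "circle_equiv J x y \<Longrightarrow> K \<inter> J = {} \<Longrightarrow> cell_norm K x = cell_norm K y"
  by (intro cell_norm_cong) (auto simp: circle_equiv_def)

text \<open>Equivalent points have the same cell coordinates, hence the same radius, so they fall
  under the same branch of \<open>prolong\<close> and at the same time of \<open>N\<close>.\<close>

lemma prolong_circle_invariant: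
  assumes "finite K" "K \<inter> J = {}" "circle_invariant J (cube (K \<union> J)) \<Phi>"
    and "\<And>t. \<lbrakk>0 \<le> t; t \<le> 1\<rbrakk> \<Longrightarrow> circle_invariant J (cell_boundary K J) (N t)"
    and "x \<in> prolong_domain K J" "y \<in> prolong_domain K J" "circle_equiv J x y"
  shows "prolong K \<Phi> N x = prolong K \<Phi> N y"
proof -
  have n: "cell_norm K x = cell_norm K y" using assms by (intro circle_equiv_cell_norm)
  show ?thesis
  proof (cases "cell_norm K x \<le> 1")
    case True
    then show ?thesis
      using assms n by (auto simp: prolong_def circle_invariant_def cube_iff)
  next
    case False
    have "scale_on K (1 / cell_norm K x) x \<in> cell_boundary K J" "scale_on K (1 / cell_norm K y) y \<in> cell_boundary K J"
      using False assms prolong_domain_normalize[of K J x] prolong_domain_normalize[of K J y] n by auto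
    moreover have "circle_equiv J (scale_on K (1 / cell_norm K x) x) (scale_on K (1 / cell_norm K y) y)"
      using assms n by (simp add: circle_equiv_scale_on)
    ultimately have "N t (scale_on K (1 / cell_norm K x) x) = N t (scale_on K (1 / cell_norm K y) y)"
      if "0 \<le> t" "t \<le> 1" for t
      using assms(4)[OF that] by (simp add: circle_invariant_def)
    then show ?thesis using False n by (simp add: prolong_def)
  qed
qed

locale attached_circle =
  fixes Z A :: "'a::t2_space set" and K J :: "nat set" and j :: nat and \<Phi> and a :: 'a
  assumes fin: "finite K" "K \<noteq> {}" and disj: "K \<inter> insert j J = {}" and j: "j \<notin> J"
    and att: "attached Z A K (insert j J) \<Phi>"
    and null: "homotopic_with_canon (circle_invariant (insert j J) (cell_boundary K (insert j J)))
      (cell_boundary K (insert j J)) A \<Phi> (\<lambda>_. a)"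
begin

abbreviation "Q \<equiv> cube (insert j (K \<union> J))"

text \<open>The intermediate space between \<open>A\<close> and \<open>Z\<close>: only the cells
  over the cut of the circle \<open>j\<close> have been attached.\<close>

definition "A' = A \<union> \<Phi> ` {x \<in> Q. \<bar>x j\<bar> = 1}"

lemma Q_simps: "cube (K \<union> insert j J) = Q" "cube (insert j K \<union> J) = Q"
  by simp_all

lemma att_unfold:
  shows "closed A" "continuous_on Q \<Phi>" "Z = A \<union> \<Phi> ` Q"
    and \<Phi>A: "\<And>x. x \<in> Q \<Longrightarrow> \<Phi> x \<in> A \<longleftrightarrow> cell_norm K x = 1"
    and \<Phi>_resp: "\<And>x y. \<lbrakk>x \<in> Q; y \<in> Q; circle_equiv (insert j J) x y\<rbrakk> \<Longrightarrow> \<Phi> x = \<Phi> y"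
    and \<Phi>_inj: "\<And>x y. \<lbrakk>x \<in> Q; y \<in> Q; \<Phi> x = \<Phi> y; \<Phi> x \<notin> A\<rbrakk> \<Longrightarrow> circle_equiv (insert j J) x y"
  using att unfolding attached_def circle_invariant_def Q_simps by blast+

lemma upd_in_Q: "x \<in> cube (K \<union> J) \<Longrightarrow> x(j := 1) \<in> Q"
  by (auto simp: cube_def)

lemma cell_norm_upd [simp]: "cell_norm K (x(j := y)) = cell_norm K x"
  using disj by (intro cell_norm_cong) auto

lemma continuous_on_upd: "continuous_on S (\<lambda>x. x(j := 1::real))"
  by (rule continuous_on_coordinatewise_then_product) (intro continuous_intros)

lemma attached_face: "attached A' A K J (\<lambda>x. \<Phi> (x(j := 1)))"
  unfolding attached_def
proof (intro conjI ballI impI)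
  show "continuous_on (cube (K \<union> J)) (\<lambda>x. \<Phi> (x(j := 1)))"
    by (rule continuous_on_compose2[OF att_unfold(2) continuous_on_upd]) (auto simp: upd_in_Q)
  show "A' = A \<union> (\<lambda>x. \<Phi> (x(j := 1))) ` cube (K \<union> J)"
  proof -
    have "\<Phi> x \<in> (\<lambda>x. \<Phi> (x(j := 1))) ` cube (K \<union> J)" if x: "x \<in> Q" "\<bar>x j\<bar> = 1" for x
    proof (rule image_eqI)
      \<comment> \<open>Points of \<open>cube (K \<union> J)\<close> vanish at \<open>j\<close>, so
        the coordinate is reset; the face map then represents both end points by 1.\<close>
      show "x(j := 0) \<in> cube (K \<union> J)" using x(1) disj j by (auto simp: cube_def)
      have "x(j := 1) \<in> Q" using x by (auto simp: cube_def)
      moreover have "circle_equiv (insert j J) x (x(j := 1))" using x(2) by (auto simp: circle_equiv_def)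
      ultimately show "\<Phi> x = \<Phi> ((x(j := 0))(j := 1))" using x(1) by (simp add: \<Phi>_resp)
    qed
    then show ?thesis using upd_in_Q by (force simp: A'_def)
  qed
  show "circle_invariant J (cube (K \<union> J)) (\<lambda>x. \<Phi> (x(j := 1)))"
    unfolding circle_invariant_def by (auto simp: circle_equiv_def intro!: \<Phi>_resp upd_in_Q)
  show "circle_equiv J x y" if "x \<in> cube (K \<union> J)" "y \<in> cube (K \<union> J)" "\<Phi> (x(j := 1)) = \<Phi> (y(j := 1))"
    "\<Phi> (x(j := 1)) \<notin> A" for x y
  proof -
    have "circle_equiv (insert j J) (x(j := 1)) (y(j := 1))"
      using that by (intro \<Phi>_inj upd_in_Q)
    moreover have "x j = y j" using that(1,2) disj j by (auto simp: cube_def)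
    ultimately show ?thesis unfolding circle_equiv_def by (metis fun_upd_other insert_iff)
  qed
qed (use att_unfold(1) in \<open>auto simp: \<Phi>A upd_in_Q\<close>)

lemma null_face: "homotopic_with_canon (circle_invariant J (cell_boundary K J)) (cell_boundary K J) A (\<lambda>x. \<Phi> (x(j := 1))) (\<lambda>_. a)"
proof -
  have "homotopic_with_canon (circle_invariant J (cell_boundary K J)) (cell_boundary K J) A (\<Phi> \<circ> (\<lambda>x. x(j := 1))) ((\<lambda>_. a) \<circ> (\<lambda>x. x(j := 1)))"
  proof (rule homotopic_with_compose_continuous_map_right[OF null])
    have *: "x(j := 1) \<in> cell_boundary K (insert j J)" if "x \<in> cell_boundary K J" for x
      using that upd_in_Q by (auto simp: cell_boundary_def)
    then show "continuous_map (top_of_set (cell_boundary K J)) (top_of_set (cell_boundary K (insert j J))) (\<lambda>x. x(j := 1))"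
      by (auto simp: continuous_on_upd)
    show "circle_invariant J (cell_boundary K J) (h \<circ> (\<lambda>x. x(j := 1)))"
      if h: "circle_invariant (insert j J) (cell_boundary K (insert j J)) h" for h
      unfolding circle_invariant_def
    proof (intro ballI impI)
      fix x y assume "x \<in> cell_boundary K J" "y \<in> cell_boundary K J" "circle_equiv J x y"
      moreover from this have "circle_equiv (insert j J) (x(j := 1)) (y(j := 1))" by (auto simp: circle_equiv_def)
      ultimately show "(h \<circ> (\<lambda>x. x(j := 1))) x = (h \<circ> (\<lambda>x. x(j := 1))) y"
        using h * by (simp add: circle_invariant_def)
    qed
  qed
  then show ?thesis by (simp add: o_def)
qed

lemma compact_face: "compact {x \<in> Q. \<bar>x j\<bar> = 1}"
proof -
  have "closed {x :: nat \<Rightarrow> real. \<bar>x j\<bar> = 1}"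
    by (intro closed_Collect_eq continuous_intros)
  then have "compact (Q \<inter> {x. \<bar>x j\<bar> = 1})"
    by (rule compact_Int_closed[OF compact_cube])
  then show ?thesis by (simp add: Collect_conj_eq)
qed

lemma attached_rest: "attached Z A' (insert j K) J \<Phi>"
  unfolding attached_def Q_simps
proof (intro conjI ballI impI)
  have "closed (\<Phi> ` {x \<in> Q. \<bar>x j\<bar> = 1})"
    using compact_face att_unfold(2)
    by (intro compact_imp_closed compact_continuous_image) (auto intro: continuous_on_subset)
  then show "closed A'" unfolding A'_def using att_unfold(1) by (intro closed_Un)
  show "Z = A' \<union> \<Phi> ` Q" using att_unfold(3) by (auto simp: A'_def)
  have A'_iff: "\<Phi> x \<in> A' \<longleftrightarrow> cell_norm K x = 1 \<or> \<bar>x j\<bar> = 1" if x: "x \<in> Q" for x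
  proof
    assume "\<Phi> x \<in> A'"
    then consider "\<Phi> x \<in> A" | y where "\<Phi> x \<notin> A" "y \<in> Q" "\<bar>y j\<bar> = 1" "\<Phi> x = \<Phi> y"
      unfolding A'_def by blast
    then show "cell_norm K x = 1 \<or> \<bar>x j\<bar> = 1"
    proof cases
      case 2
      then have "circle_equiv (insert j J) x y" using x by (intro \<Phi>_inj) auto
      then show ?thesis using 2 by (metis circle_equiv_def)
    qed (use \<Phi>A x in auto)
  qed (use x \<Phi>A in \<open>auto simp: A'_def\<close>)
  have *: "cell_norm (insert j K) x = 1 \<longleftrightarrow> cell_norm K x = 1 \<or> \<bar>x j\<bar> = 1" if "x \<in> Q" for x
  proof -
    have "cell_norm K x \<le> 1" "\<bar>x j\<bar> \<le> 1" using that fin(1) by (auto simp: cube_def cell_norm_le_iff)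
    then show ?thesis using fin(1) by (auto simp: cell_norm_insert max_def)
  qed
  show "(\<Phi> x \<in> A') = (cell_norm (insert j K) x = 1)" if "x \<in> Q" for x
    using that by (simp add: A'_iff *)
  show "circle_invariant J Q \<Phi>"
    unfolding circle_invariant_def by (auto intro!: \<Phi>_resp elim: circle_equiv_mono)
  show "circle_equiv J x y" if "x \<in> Q" "y \<in> Q" "\<Phi> x = \<Phi> y" "\<Phi> x \<notin> A'" for x y
  proof -
    have "circle_equiv (insert j J) x y" using that by (intro \<Phi>_inj) (auto simp: A'_def)
    \<comment> \<open>Off \<open>A'\<close> the coordinate \<open>j\<close> is interior, so the
      points cannot be identified through it and the equivalence only involves
      \<open>J\<close>.\<close>
    moreover have "\<bar>x j\<bar> \<noteq> 1" using that A'_iff by blast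
    ultimately show ?thesis unfolding circle_equiv_def by blast
  qed
qed (rule att_unfold(2))

text \<open>
  First push the cell coordinates outwards, along the null homotopy beyond radius 1; then the
  map no longer depends on the coordinate \<open>j\<close> and its cell coordinates can be contracted.
\<close>

lemma null_rest:
  "homotopic_with_canon (circle_invariant J (cell_boundary (insert j K) J)) (cell_boundary (insert j K) J) A' \<Phi> (\<lambda>_. a)"
proof -
  let ?J = "insert j J" and ?X = "cell_boundary (insert j K) J"
  obtain N :: "real \<Rightarrow> (nat \<Rightarrow> real) \<Rightarrow> 'a" where
    N: "continuous_on ({0..1} \<times> cell_boundary K ?J) (\<lambda>y. N (fst y) (snd y))"
      "\<And>t x. \<lbrakk>0 \<le> t; t \<le> 1; x \<in> cell_boundary K ?J\<rbrakk> \<Longrightarrow> N t x \<in> A"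
      "\<And>x. N 0 x = \<Phi> x" "\<And>x. N 1 x = a" "\<And>t. \<lbrakk>0 \<le> t; t \<le> 1\<rbrakk> \<Longrightarrow> circle_invariant ?J (cell_boundary K ?J) (N t)"
    by (rule homotopic_with_canonE[OF null]) blast
  define E where "E = prolong_domain K ?J"
  define e where "e = prolong K \<Phi> N"
  have QE: "x \<in> Q \<longleftrightarrow> x \<in> E \<and> cell_norm K x \<le> 1" for x
    using cube_iff[OF fin(1) disj] by (simp add: E_def)
  have e: "continuous_on E e"
    unfolding E_def e_def using att_unfold(2) N(1,3) fin disj by (intro continuous_on_prolong) (simp_all add: Q_simps)
  have eA: "e x \<in> A" if "x \<in> E" "1 \<le> cell_norm K x" for x
    using that fin disj N unfolding E_def e_def by (intro prolong_mem[where J = ?J]) auto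
  have ea: "e x = a" if "x \<in> E" "2 \<le> cell_norm K x" for x
    using that fin disj N unfolding E_def e_def by (intro prolong_2[where J = ?J]) auto
  have e_circle_invariant: "e x = e y" if "x \<in> E" "y \<in> E" "circle_equiv ?J x y" for x y
    unfolding e_def
  proof (rule prolong_circle_invariant[OF fin(1) disj _ N(5)])
    show "circle_invariant ?J (cube (K \<union> ?J)) \<Phi>" using att unfolding attached_def by blast
  qed (use that in \<open>auto simp: E_def\<close>)
  have eA': "e x \<in> A'" if "x \<in> E" "\<bar>x j\<bar> = 1 \<or> 1 \<le> cell_norm K x" for x
  proof (cases "cell_norm K x < 1")
    case True
    then show ?thesis using that by (auto simp: e_def prolong_def A'_def QE)
  next
    case False
    then show ?thesis using eA[of x] that by (auto simp: A'_def)
  qed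
  have XE: "x \<in> E" "cell_norm K x \<le> 1" "cell_norm K x = 1 \<or> \<bar>x j\<bar> = 1" if "x \<in> ?X" for x
    using that fin by (auto simp: cell_boundary_def QE cell_norm_insert max_def split: if_splits)
  have sE: "scale_on K c x \<in> E" if "x \<in> E" for c x
    using that disj by (simp add: E_def scale_on_prolong_domain)
  have rs: "cell_norm K (scale_on K c x) = \<bar>c\<bar> * cell_norm K x" for c x
    using fin by (simp add: cell_norm_scale_on)
  have circle_equiv: "circle_equiv ?J x y" if "circle_equiv J x y" for x y
    using that by (auto elim: circle_equiv_mono)
  have "homotopic_with_canon (circle_invariant J ?X) ?X A' \<Phi> (\<lambda>x. e (scale_on K 2 x))"
  proof (rule homotopic_with_canonI[where h = "\<lambda>s x. e (scale_on K (1 + s) x)"])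
    show "continuous_on ({0..1} \<times> ?X) (\<lambda>y. e (scale_on K (1 + fst y) (snd y)))"
      by (rule continuous_on_compose2[OF e])
         (auto intro!: continuous_intros sE[OF XE(1)])
    \<comment> \<open>A boundary point either has \<open>j\<close> at an end point, which scaling
      preserves and which keeps the image in \<open>A'\<close> at any radius, or has radius 1, and
      then moving outwards stays in \<open>A\<close>.\<close>
    show "e (scale_on K (1 + t) x) \<in> A'" if "0 \<le> t" "t \<le> 1" "x \<in> ?X" for t x
    proof (rule eA')
      show "scale_on K (1 + t) x \<in> E" using XE that by (simp add: sE)
      have "scale_on K (1 + t) x j = x j" using disj by (auto simp: scale_on_def)
      then show "\<bar>scale_on K (1 + t) x j\<bar> = 1 \<or> 1 \<le> cell_norm K (scale_on K (1 + t) x)"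
        using XE(3)[OF that(3)] that by (auto simp: rs)
    qed
    show "e (scale_on K (1 + 0) x) = \<Phi> x" if "x \<in> ?X" for x
      using XE[OF that] by (auto simp: e_def prolong_def)
    show "circle_invariant J ?X (\<lambda>x. e (scale_on K (1 + t) x))" for t
      unfolding circle_invariant_def using disj by (auto intro!: e_circle_invariant sE[OF XE(1)] circle_equiv[OF circle_equiv_scale_on])
    show "circle_invariant J ?X h \<longleftrightarrow> circle_invariant J ?X k" if "\<And>x. x \<in> ?X \<Longrightarrow> h x = k x" for h k :: "_ \<Rightarrow> 'a"
      using that by (rule circle_invariant_cong)
  qed simp
  moreover have "homotopic_with_canon (circle_invariant J ?X) ?X A' (\<lambda>x. e (scale_on K 2 x)) (\<lambda>_. a)"
  proof -
    \<comment> \<open>\<open>m u\<close> puts \<open>j\<close> at the end point 1 at once and moves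
      the cell coordinates linearly to 1. At \<open>u = 0\<close> the jump in \<open>j\<close> is
      invisible to \<open>e\<close> after doubling: at an end point it is an identification, and
      elsewhere the radius is 1, so the doubled point goes to \<open>a\<close> in any case.\<close>
    define m :: "real \<Rightarrow> (nat \<Rightarrow> real) \<Rightarrow> nat \<Rightarrow> real" where "m u x = (\<lambda>i. if i \<in> K then (1 - u) * x i + u else if i = j then 1 else x i)" for u x
    have mE: "m u x \<in> E" if "x \<in> ?X" for u x
      using XE(1)[OF that] disj by (auto simp: E_def prolong_domain_def m_def)
    \<comment> \<open>At the end all cell coordinates are 1; since \<open>K\<close> is nonempty the
      radius is at least 1 and doubling reaches the region where \<open>e\<close> is
      constant.\<close>
    have m1: "2 \<le> cell_norm K (scale_on K 2 (m 1 x))" for x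
    proof -
      obtain i where "i \<in> K" using fin(2) by blast
      then have "\<bar>m 1 x i\<bar> \<le> cell_norm K (m 1 x)" using fin(1) by (intro abs_le_cell_norm)
      then show ?thesis using \<open>i \<in> K\<close> by (simp add: rs) (simp add: m_def)
    qed
    show ?thesis
    proof (rule homotopic_with_canonI[where h = "\<lambda>u x. e (scale_on K 2 (m u x))"])
      have "continuous_on ({0..1} \<times> ?X) (\<lambda>y. m (fst y) (snd y) i)" for i
      proof (cases "i \<in> K")
        case True
        then show ?thesis by (simp add: m_def) (intro continuous_intros)
      next
        case False
        then show ?thesis by (cases "i = j") (simp_all add: m_def continuous_intros)
      qed
      then show "continuous_on ({0..1} \<times> ?X) (\<lambda>y. e (scale_on K 2 (m (fst y) (snd y))))"
        by (intro continuous_on_compose2[OF e] continuous_intros) (auto intro!: sE mE)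
      show "e (scale_on K 2 (m u x)) \<in> A'" if "x \<in> ?X" for u x
        using mE[OF that] disj by (intro eA' sE) (auto simp: scale_on_def m_def)
      show "e (scale_on K 2 (m 0 x)) = e (scale_on K 2 x)" if x: "x \<in> ?X" for x
      proof (cases "\<bar>x j\<bar> = 1")
        case True
        then have "circle_equiv ?J (m 0 x) x" by (auto simp: circle_equiv_def m_def)
        then show ?thesis using disj by (intro e_circle_invariant sE[OF mE[OF x]] sE[OF XE(1)[OF x]] circle_equiv_scale_on) auto
      next
        case False
        then have "cell_norm K x = 1" using XE[OF x] by auto
        moreover have "cell_norm K (m 0 x) = cell_norm K x"
          using disj by (intro cell_norm_cong) (auto simp: m_def)
        ultimately show ?thesis using mE[OF x] XE[OF x] by (simp add: ea sE rs)
      qed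
      show "e (scale_on K 2 (m 1 x)) = a" if "x \<in> ?X" for x
        using mE[OF that] m1 by (simp add: ea sE)
      show "circle_invariant J ?X (\<lambda>x. e (scale_on K 2 (m u x)))" for u
        unfolding circle_invariant_def
      proof (intro ballI impI)
        fix x y assume xy: "x \<in> ?X" "y \<in> ?X" "circle_equiv J x y"
        have "circle_equiv J (m u x) (m u y)"
          unfolding circle_equiv_def
        proof
          fix i
          show "m u x i = m u y i \<or> i \<in> J \<and> \<bar>m u x i\<bar> = 1 \<and> \<bar>m u y i\<bar> = 1"
          proof (cases "i \<in> K")
            case True
            then have "x i = y i" using disj by (intro circle_equiv_outside[OF xy(3)]) auto
            then show ?thesis using True by (simp add: m_def)
          next
            case False
            then show ?thesis using xy(3) by (auto simp: m_def circle_equiv_def)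
          qed
        qed
        then show "e (scale_on K 2 (m u x)) = e (scale_on K 2 (m u y))"
          using xy disj by (intro e_circle_invariant sE mE circle_equiv[OF circle_equiv_scale_on]) auto
      qed
      show "circle_invariant J ?X h \<longleftrightarrow> circle_invariant J ?X k" if "\<And>x. x \<in> ?X \<Longrightarrow> h x = k x" for h k :: "_ \<Rightarrow> 'a"
        using that by (rule circle_invariant_cong)
    qed
  qed
  ultimately show ?thesis by (rule homotopic_with_trans)
qed

end

section \<open>Bouquets of spheres\<close>

definition unit_sphere :: "nat \<Rightarrow> (nat \<Rightarrow> real) set" where
  "unit_sphere d = {x. (\<Sum>i\<le>d. (x i)\<^sup>2) = 1 \<and> (\<forall>i>d. x i = 0)}"

text \<open>
  A model of the wedge of \<open>c k\<close> spheres of dimension \<open>Suc k\<close>, for all \<open>k\<close>, inside the product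
  of the spheres, so that its topology is that of a type class.
\<close>

definition bouquet :: "(nat \<Rightarrow> nat) \<Rightarrow> (nat \<times> nat \<Rightarrow> nat \<Rightarrow> real) set" where
  "bouquet c = {w. (\<forall>k i. if i < c k then w (k, i) \<in> unit_sphere (Suc k) else w (k, i) = sphere_base) \<and>
     (\<forall>p q. p \<noteq> q \<longrightarrow> w p = sphere_base \<or> w q = sphere_base)}"

abbreviation bouquet_base :: "nat \<times> nat \<Rightarrow> nat \<Rightarrow> real" where
  "bouquet_base \<equiv> \<lambda>_. sphere_base"

lemma sphere_base_in_unit_sphere [simp]: "sphere_base \<in> unit_sphere d"
proof -
  have "(\<Sum>i\<le>d. (sphere_base i)\<^sup>2) = (\<Sum>i\<le>d. if i = 0 then 1 else 0)"
    by (intro sum.cong) (auto simp: sphere_base_def)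
  then show ?thesis by (auto simp: unit_sphere_def sphere_base_def)
qed

lemma closed_unit_sphere: "closed (unit_sphere d)"
  unfolding unit_sphere_def
  by (intro closed_Collect_conj closed_Collect_eq closed_Collect_all closed_Collect_imp open_Collect_const)
     (intro continuous_intros)+

lemma closed_bouquet: "closed (bouquet c)"
proof -
  have c: "closed {w :: nat \<times> nat \<Rightarrow> nat \<Rightarrow> real. w p \<in> S}" if "closed S" for p S
    using closed_vimage[OF that continuous_on_apply[of UNIV p]] by (simp add: vimage_def)
  have b: "closed {w :: nat \<times> nat \<Rightarrow> nat \<Rightarrow> real. w p = sphere_base}" for p
    using c[of "{sphere_base}" p] by simp
  have "closed {w. if i < c k then w (k, i) \<in> unit_sphere (Suc k) else w (k, i) = sphere_base}" for k i
    using c[OF closed_unit_sphere] b by (cases "i < c k") auto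
  then show ?thesis
    unfolding bouquet_def
    by (intro closed_Collect_conj closed_Collect_all closed_Collect_imp closed_Collect_disj open_Collect_const b)
qed

text \<open>Inverse stereographic projection of \<open>v / (1 - cell_norm K v)\<close>; \<open>s\<close> enumerates \<open>K\<close>.\<close>

definition cell_den :: "nat set \<Rightarrow> (nat \<Rightarrow> real) \<Rightarrow> real" where
  "cell_den K v = (\<Sum>i\<in>K. (v i)\<^sup>2) + (1 - cell_norm K v)\<^sup>2"

text \<open>The usual stereographic formulas with denominators cleared by the square of
  \<open>1 - cell_norm K v\<close>. In this form they remain valid at radius 1, where they give the
  base point.\<close>

definition cell_unit_sphere :: "nat set \<Rightarrow> (nat \<Rightarrow> nat) \<Rightarrow> (nat \<Rightarrow> real) \<Rightarrow> nat \<Rightarrow> real" where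
  "cell_unit_sphere K s v i =
     (if i = 0 then 1 - 2 * (1 - cell_norm K v)\<^sup>2 / cell_den K v
      else if i \<le> card K then 2 * (1 - cell_norm K v) * v (s i) / cell_den K v else 0)"

lemma cell_den_pos:
  assumes "finite K"
  shows "0 < cell_den K v"
proof (cases "\<forall>i\<in>K. v i = 0")
  case True
  then have "cell_norm K v \<le> 0" using assms by (simp add: cell_norm_le_iff)
  then show ?thesis
    unfolding cell_den_def by (intro add_nonneg_pos sum_nonneg) auto
next
  case False
  then obtain i where i: "i \<in> K" "v i \<noteq> 0" by auto
  then have "0 < (\<Sum>i\<in>K. (v i)\<^sup>2)" using assms by (intro sum_pos2[of K i]) auto
  then show ?thesis unfolding cell_den_def by (intro add_pos_nonneg) auto
qed

section \<open>A cell modulo its boundary as a sphere\<close>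

context
  fixes K :: "nat set" and s :: "nat \<Rightarrow> nat"
  assumes K: "finite K" and s: "bij_betw s {1..card K} K"
begin

lemma sum_reindex_cell: "(\<Sum>i\<in>{1..card K}. g (s i)) = (\<Sum>i\<in>K. g i)" for g :: "nat \<Rightarrow> real"
  by (rule sum.reindex_bij_betw[OF s])

lemma cell_unit_sphere_0: "cell_norm K v = 1 \<Longrightarrow> cell_unit_sphere K s v = sphere_base"
  by (auto simp: cell_unit_sphere_def sphere_base_def)

lemma sum_unit_sphere: "(\<Sum>i\<le>d. (x i)\<^sup>2) = (x 0)\<^sup>2 + (\<Sum>i\<in>{1..d}. (x i)\<^sup>2)" for x :: "nat \<Rightarrow> real"
proof -
  have "{..d} = insert 0 {1..d}" by auto
  then show ?thesis by simp
qed

lemma cell_unit_sphere_in_unit_sphere: "cell_unit_sphere K s v \<in> unit_sphere (card K)"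
proof -
  let ?c = "1 - cell_norm K v" and ?V = "\<Sum>i\<in>K. (v i)\<^sup>2" and ?D = "cell_den K v"
  have D: "?D > 0" "?D = ?V + ?c\<^sup>2" using cell_den_pos[OF K] by (auto simp: cell_den_def)
  have "(\<Sum>i\<le>card K. (cell_unit_sphere K s v i)\<^sup>2)
      = (1 - 2 * ?c\<^sup>2 / ?D)\<^sup>2 + (\<Sum>i\<in>{1..card K}. (2 * ?c * v (s i) / ?D)\<^sup>2)"
    unfolding sum_unit_sphere by (intro arg_cong2[where f = "(+)"] sum.cong) (auto simp: cell_unit_sphere_def)
  also have "(\<Sum>i\<in>{1..card K}. (2 * ?c * v (s i) / ?D)\<^sup>2) = (\<Sum>i\<in>K. (2 * ?c * v i / ?D)\<^sup>2)"
    by (rule sum_reindex_cell)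
  also have "\<dots> = 4 * ?c\<^sup>2 * ?V / ?D\<^sup>2"
  proof -
    have "(\<Sum>i\<in>K. (2 * c * v i / D)\<^sup>2) = 4 * c\<^sup>2 * ?V / D\<^sup>2" for c D
      by (simp add: power_divide power_mult_distrib sum_distrib_left sum_divide_distrib)
    then show ?thesis .
  qed
  also have "(1 - 2 * ?c\<^sup>2 / ?D)\<^sup>2 + 4 * ?c\<^sup>2 * ?V / ?D\<^sup>2 = ((?D - 2 * ?c\<^sup>2)\<^sup>2 + 4 * ?c\<^sup>2 * ?V) / ?D\<^sup>2"
    using D(1) by (simp add: field_simps power2_eq_square)
  also have "(?D - 2 * ?c\<^sup>2)\<^sup>2 + 4 * ?c\<^sup>2 * ?V = ?D\<^sup>2"
    unfolding D(2) by (simp add: power2_eq_square algebra_simps)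
  also have "?D\<^sup>2 / ?D\<^sup>2 = 1" using D(1) by simp
  finally show ?thesis by (auto simp: unit_sphere_def cell_unit_sphere_def)
qed

lemma continuous_on_cell_unit_sphere: "continuous_on S (cell_unit_sphere K s)"
proof (rule continuous_on_coordinatewise_then_product)
  fix i
  have D: "cell_den K v \<noteq> 0" for v using cell_den_pos[OF K, of v] by simp
  have c: "continuous_on S (\<lambda>v. cell_den K v)"
    unfolding cell_den_def by (intro continuous_intros K)
  consider "i = 0" | "i \<noteq> 0" "i \<le> card K" | "i \<noteq> 0" "\<not> i \<le> card K" by blast
  then show "continuous_on S (\<lambda>v. cell_unit_sphere K s v i)"
  proof cases
    case 1
    then show ?thesis unfolding cell_unit_sphere_def using D by simp (intro continuous_intros c K; simp)
  next
    case 2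
    then show ?thesis unfolding cell_unit_sphere_def using D by simp (intro continuous_intros c K; simp)
  qed (simp add: cell_unit_sphere_def)
qed

lemma cell_unit_sphere_eq_base_iff: "cell_unit_sphere K s v = sphere_base \<longleftrightarrow> cell_norm K v = 1"
proof
  assume "cell_unit_sphere K s v = sphere_base"
  then have "cell_unit_sphere K s v 0 = 1" by (simp add: sphere_base_def)
  then show "cell_norm K v = 1" using cell_den_pos[OF K, of v] by (simp add: cell_unit_sphere_def)
qed (rule cell_unit_sphere_0)

lemma cell_unit_sphere_inj:
  assumes v: "v \<in> cube K" "v' \<in> cube K" and eq: "cell_unit_sphere K s v = cell_unit_sphere K s v'" and "cell_norm K v \<noteq> 1"
  shows "v = v'"
proof -
  have "cell_norm K v' \<noteq> 1"
    using assms(4) eq cell_unit_sphere_eq_base_iff by metis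
  moreover have "cell_norm K v \<le> 1" "cell_norm K v' \<le> 1" using v K by (auto simp: cube_def cell_norm_le_iff)
  ultimately have c: "0 < 1 - cell_norm K v" "0 < 1 - cell_norm K v'" using assms(4) by auto
  \<comment> \<open>Stereographic projection from the base point recovers
    \<open>u / (1 - cell_norm K u)\<close>.\<close>
  have stereo: "cell_unit_sphere K s u i / (1 - cell_unit_sphere K s u 0) = u (s i) / (1 - cell_norm K u)"
    if "0 < 1 - cell_norm K u" "i \<in> {1..card K}" for u i
  proof -
    have "2 * c * z / D / (1 - (1 - 2 * c\<^sup>2 / D)) = z / c" if "0 < c" "0 < D" for c z D :: real
      using that by (simp add: field_simps power2_eq_square)
    from this[OF that(1) cell_den_pos[OF K]] show ?thesis
      using that(2) by (simp add: cell_unit_sphere_def)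
  qed
  have *: "v i / (1 - cell_norm K v) = v' i / (1 - cell_norm K v')" if "i \<in> K" for i
  proof -
    obtain l where "l \<in> {1..card K}" "i = s l" using s \<open>i \<in> K\<close> unfolding bij_betw_def by blast
    then show ?thesis using stereo[OF c(1), of l] stereo[OF c(2), of l] eq by simp
  qed
  \<comment> \<open>Taking norms, \<open>r / (1 - r)\<close> is the same for both points; it
    determines \<open>r\<close>, and then the coordinates themselves.\<close>
  have "cell_norm K v / (1 - cell_norm K v) = cell_norm K (scale_on K (1 / (1 - cell_norm K v)) v)"
    using c K by (simp add: cell_norm_scale_on)
  also have "\<dots> = cell_norm K (scale_on K (1 / (1 - cell_norm K v')) v')"
    using * by (intro cell_norm_cong) (simp add: scale_on_def)
  also have "\<dots> = cell_norm K v' / (1 - cell_norm K v')"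
    using c K by (simp add: cell_norm_scale_on)
  finally have "cell_norm K v = cell_norm K v'" using c by (simp add: field_simps)
  then have "v i = v' i" for i
    using *[of i] c v by (cases "i \<in> K") (auto simp: cube_def)
  then show ?thesis by blast
qed

text \<open>The preimage is explicit: project \<open>x\<close> stereographically to
  \<open>y\<close>, then \<open>y / (1 + cell_norm K y)\<close> inverts the radial map
  \<open>v / (1 - cell_norm K v)\<close>.\<close>

lemma cell_unit_sphere_surj:
  assumes x: "x \<in> unit_sphere (card K)" "x \<noteq> sphere_base"
  obtains v where "v \<in> cube K" "cell_unit_sphere K s v = x"
proof -
  define X where "X = (\<Sum>i\<in>{1..card K}. (x i)\<^sup>2)"
  have X: "(x 0)\<^sup>2 + X = 1" and X0: "0 \<le> X" and x0: "\<And>i. card K < i \<Longrightarrow> x i = 0"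
    using x(1) by (auto simp: unit_sphere_def sum_unit_sphere X_def sum_nonneg)
  have "x 0 \<noteq> 1"
  proof
    assume 1: "x 0 = 1"
    then have "\<forall>i\<in>{1..card K}. (x i)\<^sup>2 = 0"
      using X by (subst sum_nonneg_eq_0_iff[symmetric]) (auto simp: X_def)
    then have "x i = sphere_base i" for i
      using 1 x0[of i] by (cases "i = 0"; cases "i \<le> card K") (auto simp: sphere_base_def)
    then show False using x(2) by blast
  qed
  moreover have "(x 0)\<^sup>2 \<le> 1\<^sup>2" using X X0 by simp
  then have "x 0 \<le> 1" by (rule power2_le_imp_le) simp
  ultimately have x1: "0 < 1 - x 0" by simp
  define t where "t = inv_into {1..card K} s"
  have t: "t (s i) = i" if "i \<in> {1..card K}" for i
    using that s by (simp add: t_def bij_betw_def)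
  define y where "y i = (if i \<in> K then x (t i) / (1 - x 0) else 0)" for i
  define v where "v = scale_on K (1 / (1 + cell_norm K y)) y"
  let ?r = "cell_norm K y"
  have r: "0 \<le> ?r" using K by simp
  have nv: "cell_norm K v = ?r / (1 + ?r)" using K r by (simp add: v_def cell_norm_scale_on)
  then have c: "1 - cell_norm K v = 1 / (1 + ?r)" using r by (simp add: field_simps)
  have vc: "v i = y i * (1 - cell_norm K v)" if "i \<in> K" for i
    unfolding c using that by (simp add: v_def scale_on_def)
  have ys: "y (s i) = x i / (1 - x 0)" if "i \<in> {1..card K}" for i
    using that s t by (auto simp: y_def bij_betw_def)
  have Y: "(\<Sum>i\<in>K. (y i)\<^sup>2) = X / (1 - x 0)\<^sup>2"
  proof -
    have "(\<Sum>i\<in>K. (y i)\<^sup>2) = (\<Sum>i\<in>{1..card K}. (y (s i))\<^sup>2)" by (rule sum_reindex_cell[symmetric])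
    also have "\<dots> = (\<Sum>i\<in>{1..card K}. (x i)\<^sup>2 / (1 - x 0)\<^sup>2)"
      by (intro sum.cong) (auto simp: ys power_divide)
    finally show ?thesis by (simp add: X_def sum_divide_distrib)
  qed
  have "(\<Sum>i\<in>K. (v i)\<^sup>2) = (\<Sum>i\<in>K. (y i)\<^sup>2) * (1 - cell_norm K v)\<^sup>2"
    by (simp add: vc power_mult_distrib sum_distrib_right)
  then have D: "cell_den K v = (1 - cell_norm K v)\<^sup>2 * (X / (1 - x 0)\<^sup>2 + 1)"
    by (simp add: cell_den_def Y algebra_simps)
  have "X = (1 - x 0) * (1 + x 0)" using X by (simp add: algebra_simps power2_eq_square)
  then have "X / (1 - x 0)\<^sup>2 = (1 + x 0) / (1 - x 0)"
    using x1 by (simp add: power2_eq_square)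
  then have "X / (1 - x 0)\<^sup>2 + 1 = 2 / (1 - x 0)"
    using x1 by (simp add: field_simps)
  with D have D: "cell_den K v = (1 - cell_norm K v)\<^sup>2 * (2 / (1 - x 0))" by simp
  have c0: "1 - cell_norm K v \<noteq> 0" unfolding c using r by simp
  have "cell_unit_sphere K s v i = x i" for i
  proof -
    consider "i = 0" | "i \<noteq> 0" "i \<le> card K" | "card K < i" by linarith
    then show ?thesis
    proof cases
      case 1
      then show ?thesis using c0 x1 by (simp add: cell_unit_sphere_def D)
    next
      case 2
      then have "i \<in> {1..card K}" by simp
      then have vs: "v (s i) = x i / (1 - x 0) * (1 - cell_norm K v)"
        using s ys by (subst vc) (auto simp: bij_betw_def)
      have *: "2 * c * (z / b * c) / (c\<^sup>2 * (2 / b)) = z" if "c \<noteq> 0" "0 < b" for c z b :: real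
        using that by (simp add: power2_eq_square)
      have "cell_unit_sphere K s v i = 2 * (1 - cell_norm K v) * v (s i) / cell_den K v"
        using 2 by (simp add: cell_unit_sphere_def)
      then show ?thesis unfolding D vs *[OF c0 x1] .
    next
      case 3
      then show ?thesis using x0 by (simp add: cell_unit_sphere_def)
    qed
  qed
  moreover have "v \<in> cube K"
  proof -
    have "cell_norm K v \<le> 1" unfolding nv using r by (simp add: field_simps)
    then show ?thesis using K by (auto simp: cube_def cell_norm_le_iff) (auto simp: v_def scale_on_def y_def)
  qed
  ultimately show ?thesis using that by blast
qed

lemma attached_bouquet:
  assumes k: "card K = Suc k"
  shows "attached (bouquet (c(k := Suc (c k)))) (bouquet c) K {} (\<lambda>v. bouquet_base((k, c k) := cell_unit_sphere K s v))"
    (is "attached ?W' ?W K {} ?\<Phi>")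
  unfolding attached_def
proof (intro conjI ballI impI)
  show "closed ?W" by (rule closed_bouquet)
  have "continuous_on S (\<lambda>v. (bouquet_base((k, c k) := cell_unit_sphere K s v)) p)" for p S
    using continuous_on_cell_unit_sphere by (cases "p = (k, c k)") auto
  then show "continuous_on (cube (K \<union> {})) ?\<Phi>"
    by (rule continuous_on_coordinatewise_then_product)
  have \<Phi>W': "?\<Phi> v \<in> ?W'" for v
    using cell_unit_sphere_in_unit_sphere[of v] k by (auto simp: bouquet_def)
  \<comment> \<open>The old bouquet is the part where the new sphere coordinate rests at its base
    point, so membership is decided by the single coordinate \<open>(k, c k)\<close>.\<close>
  have W_iff: "w \<in> ?W \<longleftrightarrow> w \<in> ?W' \<and> w (k, c k) = sphere_base" for w
  proof -
    have "(\<forall>k' i. if i < c k' then w (k', i) \<in> unit_sphere (Suc k') else w (k', i) = sphere_base) \<longleftrightarrow>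
      (\<forall>k' i. if i < (c(k := Suc (c k))) k' then w (k', i) \<in> unit_sphere (Suc k') else w (k', i) = sphere_base) \<and>
      w (k, c k) = sphere_base"
      by (auto simp: less_Suc_eq split: if_splits)
    then show ?thesis unfolding bouquet_def by blast
  qed
  show "?W' = ?W \<union> ?\<Phi> ` cube (K \<union> {})"
  proof
    show "?W' \<subseteq> ?W \<union> ?\<Phi> ` cube (K \<union> {})"
    proof
      fix w assume w: "w \<in> ?W'"
      show "w \<in> ?W \<union> ?\<Phi> ` cube (K \<union> {})"
      proof (cases "w (k, c k) = sphere_base")
        case True
        then show ?thesis using w W_iff by blast
      next
        case False
        have "w (k, c k) \<in> unit_sphere (card K)"
          using w k unfolding bouquet_def mem_Collect_eq by (metis fun_upd_same lessI)
        then obtain v where v: "v \<in> cube K" "cell_unit_sphere K s v = w (k, c k)"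
          using False by (rule cell_unit_sphere_surj)
        have "w p = sphere_base" if "p \<noteq> (k, c k)" for p
          using w False that unfolding bouquet_def by blast
        then have "w = ?\<Phi> v" using v by auto
        then show ?thesis using v(1) by (intro UnI2 image_eqI) auto
      qed
    qed
    show "?W \<union> ?\<Phi> ` cube (K \<union> {}) \<subseteq> ?W'" using W_iff \<Phi>W' by blast
  qed
  show "(?\<Phi> x \<in> ?W) = (cell_norm K x = 1)" for x
    using W_iff \<Phi>W' cell_unit_sphere_eq_base_iff by simp
  show "circle_invariant {} (cube (K \<union> {})) ?\<Phi>"
  proof -
    have "x = y" if "circle_equiv {} x y" for x y using that by (auto simp: circle_equiv_def)
    then show ?thesis unfolding circle_invariant_def by blast
  qed
  show "circle_equiv {} x y" if "x \<in> cube (K \<union> {})" "y \<in> cube (K \<union> {})" "?\<Phi> x = ?\<Phi> y" "?\<Phi> x \<notin> ?W" for x y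
  proof -
    have 1: "cell_norm K x \<noteq> 1" using that(4) W_iff \<Phi>W' cell_unit_sphere_eq_base_iff by simp
    have 2: "cell_unit_sphere K s x = cell_unit_sphere K s y" using fun_cong[OF that(3), of "(k, c k)"] by simp
    have "x = y" by (rule cell_unit_sphere_inj[OF _ _ 2 1]) (use that(1,2) in auto)
    then show ?thesis by (simp add: circle_equiv_def)
  qed
qed

end

text \<open>A set \<open>S\<close> records which circles are opened into cell directions, producing
  one sphere of dimension \<open>card K + card S\<close>. The equation has \<open>Suc k\<close>
  because index \<open>k\<close> of a bouquet stands for dimension \<open>Suc k\<close>. The
  induction must leave \<open>K\<close> and the spaces arbitrary, since splitting a circle changes
  both.\<close>

theorem based_equiv_attach_torus_cell:
  fixes A :: "'a::t2_space set"
  assumes "finite J" "finite K" "K \<noteq> {}" "K \<inter> J = {}"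
    and "attached Z A K J \<Phi>"
    and "homotopic_with_canon (circle_invariant J (cell_boundary K J)) (cell_boundary K J) A \<Phi> (\<lambda>_. a)"
    and "based_equiv A a (bouquet c) bouquet_base"
  shows "based_equiv Z a (bouquet (\<lambda>k. c k + card {S. S \<subseteq> J \<and> card K + card S = Suc k})) bouquet_base"
  using assms
proof (induction J arbitrary: K Z A \<Phi> c rule: finite_induct)
  case empty
  obtain k where k: "card K = Suc k"
    using empty.prems(1,2) by (metis card_eq_0_iff not0_implies_Suc)
  obtain s where s: "bij_betw s {1..card K} K"
    using ex_bij_betw_nat_finite_1[OF empty.prems(1)] by blast
  have "based_equiv Z a (bouquet (c(k := Suc (c k)))) bouquet_base"
  proof (rule based_equiv_attached_cell[where a' = bouquet_base, OF empty.prems(1,4) attached_bouquet[OF empty.prems(1) s k]])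
    show "homotopic_with_canon (\<lambda>_. True) (cell_boundary K {}) A \<Phi> (\<lambda>_. a)"
      using empty.prems(5) by (rule homotopic_with_mono) simp
    show "bouquet_base((k, c k) := cell_unit_sphere K s x) = bouquet_base" if "x \<in> cell_boundary K {}" for x
      using that cell_unit_sphere_0[OF empty.prems(1) s, of x] by (auto simp: cell_boundary_def)
  qed (rule empty.prems)
  moreover have "c(k := Suc (c k)) = (\<lambda>k. c k + card {S :: nat set. S \<subseteq> {} \<and> card K + card S = Suc k})"
  proof
    fix k'
    have "{S :: nat set. S \<subseteq> {} \<and> card K + card S = Suc k'} = (if k' = k then {{}} else {})"
      using k by auto
    then show "(c(k := Suc (c k))) k' = c k' + card {S :: nat set. S \<subseteq> {} \<and> card K + card S = Suc k'}"
      by simp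
  qed
  ultimately show ?case by simp
next
  case (insert j J)
  interpret attached_circle Z A K J j \<Phi> a
    by unfold_locales (use insert in auto)
  let ?c = "\<lambda>k. c k + card {S. S \<subseteq> J \<and> card K + card S = Suc k}"
  \<comment> \<open>The face contributes the sets without \<open>j\<close>. Its result serves as the
    base equivalence for the second use of the induction hypothesis, where \<open>j\<close> belongs
    to the cell and the sets with \<open>j\<close> are added.\<close>
  have *: "based_equiv A' a (bouquet ?c) bouquet_base"
    by (rule insert.IH[OF insert.prems(1,2) _ attached_face null_face insert.prems(6)])
       (use insert.prems(3) in auto)
  have "based_equiv Z a (bouquet (\<lambda>k. ?c k + card {S. S \<subseteq> J \<and> card (insert j K) + card S = Suc k})) bouquet_base"
    by (rule insert.IH[OF _ _ _ attached_rest null_rest *])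
       (use insert.prems(1,3) insert.hyps(2) in auto)
  moreover have "?c k + card {S. S \<subseteq> J \<and> card (insert j K) + card S = Suc k} =
      c k + card {S. S \<subseteq> insert j J \<and> card K + card S = Suc k}" for k
  proof -
    let ?A = "{S. S \<subseteq> J \<and> card K + card S = Suc k}"
    let ?B = "{S. S \<subseteq> J \<and> card (insert j K) + card S = Suc k}"
    have fin: "finite S" if "S \<subseteq> J" for S using that insert.hyps(1) by (rule finite_subset)
    have jK: "card (insert j K) = Suc (card K)" using insert.prems(1,3) by simp
    have "{S. S \<subseteq> insert j J \<and> card K + card S = Suc k} = ?A \<union> insert j ` ?B"
    proof (intro equalityI subsetI)
      fix S assume S: "S \<in> {S. S \<subseteq> insert j J \<and> card K + card S = Suc k}"
      show "S \<in> ?A \<union> insert j ` ?B"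
      proof (cases "j \<in> S")
        case True
        have "finite S" using S insert.hyps(1) finite_subset[of S "insert j J"] by simp
        then have "card S = Suc (card (S - {j}))" using True by (rule card.remove)
        then have "S - {j} \<in> ?B" using S jK by auto
        moreover have "S = insert j (S - {j})" using True by blast
        ultimately show ?thesis by (intro UnI2 image_eqI)
      qed (use S in auto)
    next
      fix S assume "S \<in> ?A \<union> insert j ` ?B"
      then show "S \<in> {S. S \<subseteq> insert j J \<and> card K + card S = Suc k}"
      proof
        assume "S \<in> insert j ` ?B"
        then obtain T where T: "S = insert j T" "T \<subseteq> J" "card (insert j K) + card T = Suc k" by auto
        then have "card S = Suc (card T)" using insert.hyps(2) fin[of T] by (subst T(1)) (auto simp: card_insert_if)
        then show ?thesis using T jK by auto
      qed auto
    qed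
    moreover have "finite ?A" "finite ?B" using insert.hyps(1) by auto
    moreover have "?A \<inter> insert j ` ?B = {}" using insert.hyps(2) by auto
    moreover have "inj_on (insert j) ?B"
    proof (rule inj_onI)
      fix S T assume "S \<in> ?B" "T \<in> ?B" and eq: "insert j S = insert j T"
      then have "j \<notin> S" "j \<notin> T" using insert.hyps(2) by auto
      then show "S = T" using eq by (simp add: insert_ident)
    qed
    ultimately show ?thesis by (simp add: card_Un_disjoint card_image)
  qed
  ultimately show ?case by simp
qed

section \<open>The moment-angle model\<close>

text \<open>The maximum norm: its unit ball is a square, whose two real coordinates serve as cell coordinates.\<close>

definition square_norm :: "complex \<Rightarrow> real" where
  "square_norm z = max \<bar>Re z\<bar> \<bar>Im z\<bar>"

lemma square_norm_1 [simp]: "square_norm 1 = 1"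
  by (simp add: square_norm_def)

lemma square_norm_nonneg: "0 \<le> square_norm z"
  by (simp add: square_norm_def)

lemma square_norm_eq_0_iff: "square_norm z = 0 \<longleftrightarrow> z = 0"
  by (auto simp: square_norm_def complex_eq_iff max_def)

lemma square_norm_pos: "z \<noteq> 0 \<Longrightarrow> 0 < square_norm z"
  using square_norm_nonneg[of z] square_norm_eq_0_iff[of z] by linarith

lemma square_norm_of_real_mult: "square_norm (of_real r * z) = \<bar>r\<bar> * square_norm z"
  by (simp add: square_norm_def abs_mult max_mult_distrib_left)

lemma square_norm_minus [simp]: "square_norm (- z) = square_norm z"
  by (simp add: square_norm_def)

lemma square_norm_segment:
  assumes "0 \<le> t" "t \<le> 1" "square_norm z \<le> 1"
  shows "square_norm ((1 - of_real t) * z + of_real t) \<le> 1"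
proof -
  have "\<bar>(1 - t) * x + t * y\<bar> \<le> 1" if "\<bar>x\<bar> \<le> 1" "\<bar>y\<bar> \<le> 1" for x y
  proof -
    have "\<bar>(1 - t) * x + t * y\<bar> \<le> \<bar>(1 - t) * x\<bar> + \<bar>t * y\<bar>" by (rule abs_triangle_ineq)
    also have "\<dots> \<le> (1 - t) * 1 + t * 1"
      unfolding abs_mult using assms that by (intro add_mono mult_mono) auto
    finally show ?thesis by simp
  qed
  from this[of "Re z" 1] this[of "Im z" 0] show ?thesis
    using assms by (simp add: square_norm_def)
qed

lemma continuous_on_square_norm [continuous_intros]:
  "continuous_on S f \<Longrightarrow> continuous_on S (\<lambda>x. square_norm (f x))"
  unfolding square_norm_def by (intro continuous_intros)

text \<open>The boundary of the square, run through once over the interval from -1 to 1. Since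
  \<open>cis\<close> is -1 at both ends, the minus sign makes the ends meet at 1, the base value of
  a coordinate.\<close>

definition square_loop :: "real \<Rightarrow> complex" where
  "square_loop t = of_real (- inverse (square_norm (cis (pi * t)))) * cis (pi * t)"

lemma square_norm_cis_pos: "0 < square_norm (cis t)"
  by (intro square_norm_pos) simp

lemma square_norm_square_loop [simp]: "square_norm (square_loop t) = 1"
  using square_norm_cis_pos[of "pi * t"] by (simp only: square_loop_def square_norm_of_real_mult) simp

lemma square_loop_ends [simp]: "square_loop 1 = 1" "square_loop (- 1) = 1" "\<bar>t\<bar> = 1 \<Longrightarrow> square_loop t = 1"
proof -
  show 1: "square_loop 1 = 1" "square_loop (- 1) = 1"
    by (simp_all add: square_loop_def flip: cis_cnj)
  show "square_loop t = 1" if "\<bar>t\<bar> = 1"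
    using that 1 by (cases "t < 0") (auto simp: abs_if)
qed

lemma continuous_on_square_loop [continuous_intros]:
  assumes "continuous_on S f"
  shows "continuous_on S (\<lambda>x. square_loop (f x))"
  unfolding square_loop_def
proof (intro continuous_intros assms ballI)
  show "square_norm (cis (pi * f x)) \<noteq> 0" for x using square_norm_cis_pos[of "pi * f x"] by simp
qed

lemma square_loop_inj:
  assumes "\<bar>s\<bar> \<le> 1" "\<bar>t\<bar> \<le> 1" "square_loop s = square_loop t"
  shows "s = t \<or> \<bar>s\<bar> = 1 \<and> \<bar>t\<bar> = 1"
proof -
  \<comment> \<open>\<open>Arg\<close> takes values in the interval from -pi (excluded) to pi, so
    the parameter -1 has to be replaced by 1.\<close>
  define r where "r u = (if u = -1 then 1 else u)" for u :: real
  have Arg: "Arg (- square_loop u) = pi * r u" if "\<bar>u\<bar> \<le> 1" for u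
  proof (rule cis_Arg_unique)
    have "cis (pi * r u) = cis (pi * u)" by (simp add: r_def flip: cis_cnj)
    moreover have "- square_loop u = inverse (square_norm (cis (pi * u))) *\<^sub>R cis (pi * u)"
      by (simp add: square_loop_def scaleR_conv_of_real)
    then have "sgn (- square_loop u) = cis (pi * u)"
      using square_norm_cis_pos[of "pi * u"] by (simp only: sgn_scaleR) (simp add: sgn_div_norm)
    ultimately show "sgn (- square_loop u) = cis (pi * r u)" by simp
    show "- pi < pi * r u" "pi * r u \<le> pi"
      using that mult_strict_left_mono[of "-1" "r u" pi] mult_left_mono[of "r u" 1 pi] by (auto simp: r_def)
  qed
  have "r s = r t" using Arg[OF assms(1)] Arg[OF assms(2)] assms(3) by simp
  then show ?thesis by (auto simp: r_def split: if_splits)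
qed

lemma square_loop_surj:
  assumes "square_norm w = 1"
  obtains t where "\<bar>t\<bar> \<le> 1" "square_loop t = w"
proof -
  let ?t = "Arg (- w) / pi"
  have "w \<noteq> 0" using assms square_norm_eq_0_iff[of w] by auto
  then have c: "cis (pi * ?t) = of_real (- inverse (norm w)) * w"
    by (simp add: cis_Arg sgn_eq field_simps)
  have "square_norm (cis (pi * ?t)) = inverse (norm w)"
    unfolding c square_norm_of_real_mult using assms by simp
  then have "square_loop ?t = w"
    using \<open>w \<noteq> 0\<close> unfolding square_loop_def by (simp only: c) simp
  moreover have "\<bar>?t\<bar> \<le> 1"
    using Arg_bounded[of "- w"] by (auto simp: abs_le_iff field_simps)
  ultimately show ?thesis using that by blast
qed

text \<open>Freezing the spare coordinates at 1, a value of norm 1, lets the clause on pairs range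
  over all indices and makes \<open>moment_angle m\<close> a subset of
  \<open>moment_angle (Suc m)\<close>.\<close>

definition moment_angle :: "nat \<Rightarrow> (nat \<Rightarrow> complex) set" where
  "moment_angle m = {z. (\<forall>i. square_norm (z i) \<le> 1) \<and> (\<forall>i j. i \<noteq> j \<longrightarrow> square_norm (z i) = 1 \<or> square_norm (z j) = 1) \<and>
     (\<forall>i. i \<notin> {1..m} \<longrightarrow> z i = 1)}"

text \<open>As long as the last coordinate is off its base value, an interior coordinate among the
  first \<open>m\<close> must have index at most \<open>i\<close>. \<open>stage m 0\<close> is
  \<open>moment_angle m\<close> with the last disc glued in over the torus, \<open>stage m m\<close>
  is everything, and each step adds the points with coordinate \<open>i\<close> interior and the
  last one in the open circle.\<close>

definition stage :: "nat \<Rightarrow> nat \<Rightarrow> (nat \<Rightarrow> complex) set" where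
  "stage m i = {z \<in> moment_angle (Suc m). z (Suc m) = 1 \<or> (\<forall>j\<in>{i<..m}. square_norm (z j) = 1)}"

text \<open>Indices of complex coordinates start at 1, so slot 0 is free to hold the imaginary part
  of the disc coordinate \<open>i\<close>; slot \<open>i\<close> holds its real part.\<close>

definition chart :: "nat \<Rightarrow> nat \<Rightarrow> (nat \<Rightarrow> real) \<Rightarrow> nat \<Rightarrow> complex" where
  "chart m i x = (\<lambda>j. if j = i then Complex (x i) (x 0)
     else if j \<in> {1..Suc m} then square_loop (x j) else 1)"

lemma moment_angle_outside: "z \<in> moment_angle m \<Longrightarrow> i \<notin> {1..m} \<Longrightarrow> z i = 1"
  by (simp add: moment_angle_def)

section \<open>Moving coordinates to 1 along segments\<close>

lemma moment_angle_segment: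
  assumes "z \<in> moment_angle m" "\<And>i. i \<noteq> j \<Longrightarrow> square_norm (z i) = 1" "0 \<le> t" "t \<le> 1"
  shows "z(j := (1 - of_real t) * z j + of_real t) \<in> moment_angle m"
  using assms square_norm_segment[of t "z j"] by (auto simp: moment_angle_def)

lemma contract_coordinate:
  fixes f :: "(nat \<Rightarrow> real) \<Rightarrow> nat \<Rightarrow> complex"
  assumes f: "continuous_on X f" "circle_invariant J X f"
    and T: "\<And>x t. \<lbrakk>x \<in> X; 0 \<le> t; t \<le> 1\<rbrakk> \<Longrightarrow> (f x)(j := (1 - of_real t) * f x j + of_real t) \<in> T"
  shows "homotopic_with_canon (circle_invariant J X) X T f (\<lambda>x. (f x)(j := 1))"
proof (rule homotopic_with_canonI[where h = "\<lambda>t x. (f x)(j := (1 - of_real t) * f x j + of_real t)"])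
  have c: "continuous_on ({0..1::real} \<times> X) (\<lambda>y. f (snd y) i)" for i
    by (rule continuous_on_product_then_coordinatewise, rule continuous_on_compose2[OF f(1)])
       (auto intro: continuous_on_snd continuous_on_id)
  show "continuous_on ({0..1} \<times> X)
      (\<lambda>y. (f (snd y))(j := (1 - of_real (fst y)) * f (snd y) j + of_real (fst y)))"
    by (rule continuous_on_coordinatewise_then_product) (intro c continuous_intros)
  show "circle_invariant J X (\<lambda>x. (f x)(j := (1 - of_real t) * f x j + of_real t))" for t :: real
    using f(2) unfolding circle_invariant_def by metis
  show "circle_invariant J X h \<longleftrightarrow> circle_invariant J X k" if "\<And>x. x \<in> X \<Longrightarrow> h x = k x" for h k :: "_ \<Rightarrow> nat \<Rightarrow> complex"
    using that by (rule circle_invariant_cong)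
qed (use T in auto)

text \<open>A torus contracts one coordinate at a time: while one coordinate crosses its disc, all
  others are on their circles, so the path stays in the moment-angle complex.\<close>

lemma null_torus:
  assumes "continuous_on X f" "circle_invariant J X f"
    and "\<And>x i. x \<in> X \<Longrightarrow> square_norm (f x i) = 1"
    and "\<And>x i. x \<in> X \<Longrightarrow> i \<notin> {1..l} \<Longrightarrow> f x i = 1"
    and "l \<le> m" "moment_angle m \<subseteq> T"
  shows "homotopic_with_canon (circle_invariant J X) X T f (\<lambda>_ _. 1)"
  using assms
proof (induction l arbitrary: f)
  case 0
  have "(\<lambda>_. 1) \<in> moment_angle m" by (auto simp: moment_angle_def)
  then have "(\<lambda>_. 1) \<in> T" using 0 by blast
  moreover have "f x = (\<lambda>_. 1)" if "x \<in> X" for x using 0(4)[OF that] by auto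
  ultimately show ?case
    using 0(1,2) by (intro homotopic_with_equal) (auto simp: circle_invariant_def)
next
  case (Suc l)
  have T: "(f x)(Suc l := (1 - of_real t) * f x (Suc l) + of_real t) \<in> T"
    if "x \<in> X" "0 \<le> t" "t \<le> 1" for x t
  proof -
    have "f x \<in> moment_angle m"
      using Suc.prems(3,4)[OF that(1)] Suc.prems(5) by (auto simp: moment_angle_def)
    then show ?thesis
      using Suc.prems(3,6) that by (intro subsetD[OF Suc.prems(6)] moment_angle_segment) auto
  qed
  have "homotopic_with_canon (circle_invariant J X) X T f (\<lambda>x. (f x)(Suc l := 1))"
    by (rule contract_coordinate[OF Suc.prems(1,2) T])
  moreover have "homotopic_with_canon (circle_invariant J X) X T (\<lambda>x. (f x)(Suc l := 1)) (\<lambda>_ _. 1)"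
  proof (rule Suc.IH)
    show "continuous_on X (\<lambda>x. (f x)(Suc l := 1))"
      by (rule continuous_on_coordinatewise_then_product)
         (intro continuous_intros continuous_on_product_then_coordinatewise[OF Suc.prems(1)])
    show "circle_invariant J X (\<lambda>x. (f x)(Suc l := 1))"
      using Suc.prems(2) unfolding circle_invariant_def by metis
    show "((f x)(Suc l := 1)) i = 1" if "x \<in> X" "i \<notin> {1..l}" for x i
      using Suc.prems(4)[OF that(1), of i] that(2) by auto
  qed (use Suc.prems in auto)
  ultimately show ?case by (rule homotopic_with_trans)
qed

lemma closed_moment_angle: "closed (moment_angle m)"
  unfolding moment_angle_def
  by (intro closed_Collect_conj closed_Collect_all closed_Collect_imp closed_Collect_disj
      closed_Collect_eq closed_Collect_le open_Collect_const continuous_intros)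

lemma closed_stage: "closed (stage m i)"
proof -
  have "closed {z :: nat \<Rightarrow> complex. z (Suc m) = 1 \<or> (\<forall>j. j \<in> {i<..m} \<longrightarrow> square_norm (z j) = 1)}"
    by (intro closed_Collect_disj closed_Collect_all closed_Collect_imp
        closed_Collect_eq open_Collect_const continuous_intros)
  then have "closed (moment_angle (Suc m) \<inter> \<dots>)"
    using closed_moment_angle by (intro closed_Int)
  moreover have "moment_angle (Suc m) \<inter> {z. z (Suc m) = 1 \<or> (\<forall>j. j \<in> {i<..m} \<longrightarrow> square_norm (z j) = 1)} = stage m i"
    by (auto simp: stage_def)
  ultimately show ?thesis by simp
qed

section \<open>The family of 3-cells for the coordinate \<open>i\<close>\<close>

context
  fixes m i :: nat and K J :: "nat set"
  assumes i: "0 < i" "i \<le> m" and K_def: "K = {0, i, Suc m}" and J_def: "J = {1..m} - {i}"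
begin

lemma KJ: "finite K" "finite J" "K \<noteq> {}" "K \<inter> J = {}" "K \<union> J = {..Suc m}" "card K = 3" "card J = m - 1"
  using i by (auto simp: K_def J_def)

lemma cell_norm_K_iff: "x \<in> cube {..Suc m} \<Longrightarrow> cell_norm K x = 1 \<longleftrightarrow> \<bar>x 0\<bar> = 1 \<or> \<bar>x i\<bar> = 1 \<or> \<bar>x (Suc m)\<bar> = 1"
  using i by (subst cell_norm_eq_1_iff) (auto simp: K_def cube_def)

lemma square_norm_chart: "x \<in> cube {..Suc m} \<Longrightarrow> square_norm (chart m i x j) \<le> 1"
  using i by (auto simp: chart_def square_norm_def[of "Complex _ _"] cube_def)

lemma square_norm_chart_eq_1: "j \<noteq> i \<or> \<bar>x 0\<bar> = 1 \<or> \<bar>x i\<bar> = 1 \<Longrightarrow> x \<in> cube {..Suc m} \<Longrightarrow> square_norm (chart m i x j) = 1"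
  using i by (auto simp: chart_def square_norm_def[of "Complex _ _"] cube_def)

lemma square_norm_chart_iff: "x \<in> cube {..Suc m} \<Longrightarrow> square_norm (chart m i x i) = 1 \<longleftrightarrow> \<bar>x 0\<bar> = 1 \<or> \<bar>x i\<bar> = 1"
proof -
  assume "x \<in> cube {..Suc m}"
  then have "\<bar>x 0\<bar> \<le> 1" "\<bar>x i\<bar> \<le> 1" using i by (auto simp: cube_def)
  then show ?thesis by (auto simp: chart_def square_norm_def max_def)
qed

lemma chart_last: "chart m i x (Suc m) = square_loop (x (Suc m))"
  using i by (simp add: chart_def)

lemma chart_in_moment_angle: "x \<in> cube {..Suc m} \<Longrightarrow> chart m i x \<in> moment_angle (Suc m)"
  unfolding moment_angle_def using square_norm_chart square_norm_chart_eq_1[of _ x] i by (auto simp: chart_def)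

lemma square_loop_eq_1_iff: "\<bar>t\<bar> \<le> 1 \<Longrightarrow> square_loop t = 1 \<longleftrightarrow> \<bar>t\<bar> = 1"
  using square_loop_inj[of t 1] by auto

text \<open>The faces in directions 0 and \<open>i\<close> are the boundary of the disc, those in
  direction \<open>Suc m\<close> are where the last coordinate is 1; each of these returns the point
  to the previous stage.\<close>

lemma chart_in_stage_iff:
  assumes "x \<in> cube {..Suc m}"
  shows "chart m i x \<in> stage m (i - 1) \<longleftrightarrow> cell_norm K x = 1"
proof -
  have "(\<forall>j\<in>{i - 1<..m}. square_norm (chart m i x j) = 1) \<longleftrightarrow> square_norm (chart m i x i) = 1"
    using square_norm_chart_eq_1[of _ x] assms i by force
  moreover have "square_loop (x (Suc m)) = 1 \<longleftrightarrow> \<bar>x (Suc m)\<bar> = 1"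
    using assms by (intro square_loop_eq_1_iff) (simp add: cube_def)
  ultimately show ?thesis
    using assms by (auto simp: stage_def chart_in_moment_angle chart_last cell_norm_K_iff square_norm_chart_iff)
qed

lemma continuous_on_chart: "continuous_on S (chart m i)"
proof (rule continuous_on_coordinatewise_then_product)
  fix j
  consider "j = i" | "j \<noteq> i" "j \<in> {1..Suc m}" | "j \<noteq> i" "j \<notin> {1..Suc m}" by blast
  then show "continuous_on S (\<lambda>x. chart m i x j)"
  proof cases
    case 1
    have "continuous_on S (\<lambda>x. of_real (x i) + \<i> * of_real (x 0))" by (intro continuous_intros)
    then show ?thesis using 1 by (simp add: chart_def Complex_eq)
  next
    case 2
    then show ?thesis by (simp add: chart_def continuous_intros)
  next
    case 3
    then have "chart m i x j = 1" for x by (auto simp: chart_def)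
    then show ?thesis by simp
  qed
qed

text \<open>In a new point the interior coordinate can only be \<open>i\<close>, so every other
  coordinate lies on its circle and has a loop parameter.\<close>

lemma chart_surj:
  assumes z: "z \<in> stage m i" "z \<notin> stage m (i - 1)"
  shows "z \<in> chart m i ` cube {..Suc m}"
proof -
  have zM: "z \<in> moment_angle (Suc m)" "z (Suc m) \<noteq> 1" "\<And>j. j \<in> {i<..m} \<Longrightarrow> square_norm (z j) = 1"
    using z by (auto simp: stage_def)
  then obtain j where j: "j \<in> {i - 1<..m}" "square_norm (z j) \<noteq> 1"
    using z(2) by (auto simp: stage_def)
  have "j = i"
  proof (rule ccontr)
    assume "j \<noteq> i"
    then have "j \<in> {i<..m}" using j(1) i(1) by auto
    then show False using zM(3) j(2) by blast
  qed
  with j zM(1) have 1: "square_norm (z l) = 1" if "l \<noteq> i" for l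
    using that by (auto simp: moment_angle_def)
  then have "\<exists>t. \<bar>t\<bar> \<le> 1 \<and> square_loop t = z l" if "l \<noteq> i" for l
    using square_loop_surj[OF 1[OF that]] by blast
  then obtain t where t: "\<And>l. l \<noteq> i \<Longrightarrow> \<bar>t l\<bar> \<le> 1 \<and> square_loop (t l) = z l" by metis
  define x where "x l = (if l = 0 then Im (z i) else if l = i then Re (z i)
    else if l \<le> Suc m then t l else 0)" for l
  have "square_norm (z i) \<le> 1" using zM(1) by (simp add: moment_angle_def)
  then have "x \<in> cube {..Suc m}"
    using t i by (auto simp: cube_def x_def square_norm_def)
  moreover have "chart m i x l = z l" for l
    using t[of l] i moment_angle_outside[OF zM(1), of l] by (auto simp: chart_def x_def)
  ultimately show ?thesis by (intro image_eqI[of _ _ x]) auto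
qed

lemma attached_stage: "attached (stage m i) (stage m (i - 1)) K J (chart m i)"
  unfolding attached_def KJ(5)
proof (intro conjI ballI impI)
  have "stage m (i - 1) \<subseteq> stage m i" by (auto simp: stage_def)
  moreover have "chart m i x \<in> stage m i" if "x \<in> cube {..Suc m}" for x
    using that square_norm_chart_eq_1[of _ x] by (simp add: stage_def chart_in_moment_angle)
  ultimately show "stage m i = stage m (i - 1) \<union> chart m i ` cube {..Suc m}"
    using chart_surj by blast
  show "circle_invariant J (cube {..Suc m}) (chart m i)"
    unfolding circle_invariant_def
  proof (intro ballI impI)
    fix x y assume xy: "circle_equiv J x y"
    have "x 0 = y 0" "x i = y i" using xy by (auto intro: circle_equiv_outside simp: J_def)
    moreover have "square_loop (x j) = square_loop (y j)" for j
      using xy square_loop_ends(3)[of "x j"] square_loop_ends(3)[of "y j"] unfolding circle_equiv_def by metis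
    ultimately show "chart m i x = chart m i y" by (auto simp: chart_def)
  qed
  show "circle_equiv J x y" if x: "x \<in> cube {..Suc m}" and y: "y \<in> cube {..Suc m}"
    and eq: "chart m i x = chart m i y" and nA: "chart m i x \<notin> stage m (i - 1)" for x y
    unfolding circle_equiv_def
  proof
    fix j
    have i0: "x i = y i" "x 0 = y 0" using fun_cong[OF eq, of i] by (simp_all add: chart_def)
    have le: "\<bar>x l\<bar> \<le> 1" "\<bar>y l\<bar> \<le> 1" for l
      using x y by (cases "l \<le> Suc m"; simp add: cube_def)+
    have "\<bar>x (Suc m)\<bar> \<noteq> 1" using nA x chart_in_stage_iff cell_norm_K_iff by blast
    moreover have "square_loop (x j) = square_loop (y j)" if "j \<in> {1..Suc m}" "j \<noteq> i"
      using fun_cong[OF eq, of j] that by (auto simp: chart_def)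
    then have "x j = y j \<or> \<bar>x j\<bar> = 1 \<and> \<bar>y j\<bar> = 1" if "j \<in> {1..Suc m}" "j \<noteq> i"
      using square_loop_inj[OF le] that by blast
    moreover have "x j = y j" if "j \<notin> {..Suc m}"
      using that x y by (simp add: cube_def)
    moreover have "j = 0 \<or> j = i \<or> j = Suc m \<or> j \<in> J \<and> j \<in> {1..Suc m} \<and> j \<noteq> i \<or> j \<notin> {..Suc m}"
      by (auto simp: J_def)
    ultimately show "x j = y j \<or> j \<in> J \<and> \<bar>x j\<bar> = 1 \<and> \<bar>y j\<bar> = 1"
      using i0 i by auto
  qed
qed (use closed_stage continuous_on_chart chart_in_stage_iff in auto)

text \<open>Contract the coordinate \<open>Suc m\<close> first, then \<open>i\<close>, then the remaining ones.\<close>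

lemma null_stage:
  "homotopic_with_canon (circle_invariant J (cell_boundary K J)) (cell_boundary K J) (stage m (i - 1)) (chart m i) (\<lambda>_ _. 1)"
proof -
  let ?X = "cell_boundary K J" and ?T = "stage m (i - 1)"
  have X: "x \<in> cube {..Suc m}" "\<bar>x 0\<bar> = 1 \<or> \<bar>x i\<bar> = 1 \<or> \<bar>x (Suc m)\<bar> = 1" if "x \<in> ?X" for x
    using that cell_norm_K_iff by (auto simp: cell_boundary_def KJ(5))
  have circle_invariant: "circle_invariant J ?X (chart m i)"
    using attached_stage by (auto simp: attached_def circle_invariant_def cell_boundary_def)
  have sub: "moment_angle m \<subseteq> ?T" by (auto simp: moment_angle_def stage_def)
  define f where "f x = (chart m i x)(Suc m := 1)" for x
  define g where "g x = (f x)(i := 1)" for x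
  have cf: "continuous_on ?X f" unfolding f_def
    by (rule continuous_on_coordinatewise_then_product)
       (intro continuous_intros continuous_on_product_then_coordinatewise[OF continuous_on_chart])
  have cg: "continuous_on ?X g" unfolding g_def
    by (rule continuous_on_coordinatewise_then_product)
       (intro continuous_intros continuous_on_product_then_coordinatewise[OF cf])
  have rf: "circle_invariant J ?X f" using circle_invariant unfolding circle_invariant_def f_def by metis
  have rg: "circle_invariant J ?X g" using rf unfolding circle_invariant_def g_def by metis
  have f_in: "f x \<in> moment_angle m" if "x \<in> ?X" for x
    using chart_in_moment_angle[OF X(1)[OF that]] by (auto simp: moment_angle_def f_def)
  have f1: "square_norm (f x j) = 1" if "x \<in> ?X" "j \<noteq> i" for x j
    using square_norm_chart_eq_1[of j x] X(1)[OF that(1)] that by (simp add: f_def)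
  have "homotopic_with_canon (circle_invariant J ?X) ?X ?T (chart m i) f"
    unfolding f_def
  proof (rule contract_coordinate[OF continuous_on_chart circle_invariant])
    fix x and t :: real assume x: "x \<in> ?X" and t: "0 \<le> t" "t \<le> 1"
    let ?z = "chart m i x"
    let ?z' = "?z(Suc m := (1 - of_real t) * ?z (Suc m) + of_real t)"
    have z: "?z \<in> ?T" using chart_in_stage_iff X x by (auto simp: cell_norm_K_iff)
    show "?z' \<in> ?T"
    proof (cases "?z (Suc m) = 1")
      case True
      then have "?z' = ?z" by auto
      then show ?thesis using z by simp
    next
      case False
      \<comment> \<open>A boundary point whose last coordinate is not 1 lies over the boundary of
        the disc. Then all coordinates are on their circles and the last one may cross its
        disc.\<close>
      then have "\<bar>x 0\<bar> = 1 \<or> \<bar>x i\<bar> = 1" using X(2)[OF x] by (auto simp: chart_last)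
      then have 1: "square_norm (?z j) = 1" for j using X(1)[OF x] by (intro square_norm_chart_eq_1) auto
      have "?z' \<in> moment_angle (Suc m)"
        using t by (intro moment_angle_segment chart_in_moment_angle X x 1)
      then show ?thesis using 1 by (auto simp: stage_def)
    qed
  qed
  \<comment> \<open>With the last coordinate at 1 the image lies in \<open>moment_angle m\<close>,
    which is part of the lower stage, so now the coordinate \<open>i\<close> may cross its
    disc.\<close>
  moreover have "homotopic_with_canon (circle_invariant J ?X) ?X ?T f g"
    unfolding g_def
    by (rule contract_coordinate[OF cf rf]) (intro subsetD[OF sub] moment_angle_segment f_in f1)
  moreover have "homotopic_with_canon (circle_invariant J ?X) ?X ?T g (\<lambda>_ _. 1)"
  proof (rule null_torus[OF cg rg _ _ order_refl sub])
    show "square_norm (g x j) = 1" if "x \<in> ?X" for x j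
      using f1[OF that, of j] by (simp add: g_def)
    show "g x j = 1" if "x \<in> ?X" "j \<notin> {1..m}" for x j
      using moment_angle_outside[OF f_in[OF that(1)] that(2)] by (simp add: g_def)
  qed
  ultimately show ?thesis by (meson homotopic_with_trans)
qed

text \<open>With three cell coordinates, \<open>3 + card S = Suc k\<close> means
  \<open>card S = k - 2\<close>; below \<open>k = 2\<close> there is no solution, which truncated
  subtraction would hide.\<close>

lemma card_subsets_stage:
  "card {S. S \<subseteq> J \<and> card K + card S = Suc k} = (if 2 \<le> k then (m - 1) choose (k - 2) else 0)"
proof (cases "2 \<le> k")
  case True
  then have "{S. S \<subseteq> J \<and> card K + card S = Suc k} = {S. S \<subseteq> J \<and> card S = k - 2}"
    by (auto simp: KJ(6))
  then show ?thesis using True n_subsets[OF KJ(2), of "k - 2"] by (simp add: KJ(7))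
qed (simp add: KJ(6))

lemma based_equiv_stage_step:
  assumes "based_equiv (stage m (i - 1)) (\<lambda>_. 1) (bouquet c) bouquet_base"
  shows "based_equiv (stage m i) (\<lambda>_. 1)
    (bouquet (\<lambda>k. c k + (if 2 \<le> k then (m - 1) choose (k - 2) else 0))) bouquet_base"
  using based_equiv_attach_torus_cell[OF KJ(2,1,3,4) attached_stage null_stage assms]
  by (simp only: card_subsets_stage)

end

section \<open>Composing the stages and counting spheres\<close>

lemma based_equiv_trans:
  assumes "based_equiv S a T b" "based_equiv T b U c"
  shows "based_equiv S a U c"
proof -
  obtain f g where f: "continuous_on S f" "f ` S \<subseteq> T" "f a = b"
    and g: "continuous_on T g" "g ` T \<subseteq> S" "g b = a"
    and gf: "homotopic_with_canon (\<lambda>k. k a = a) S S (\<lambda>x. g (f x)) (\<lambda>x. x)"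
    and fg: "homotopic_with_canon (\<lambda>k. k b = b) T T (\<lambda>x. f (g x)) (\<lambda>x. x)" and a: "a \<in> S" "b \<in> T"
    using assms(1) unfolding based_equiv_def by blast
  obtain f' g' where f': "continuous_on T f'" "f' ` T \<subseteq> U" "f' b = c"
    and g': "continuous_on U g'" "g' ` U \<subseteq> T" "g' c = b"
    and gf': "homotopic_with_canon (\<lambda>k. k b = b) T T (\<lambda>x. g' (f' x)) (\<lambda>x. x)"
    and fg': "homotopic_with_canon (\<lambda>k. k c = c) U U (\<lambda>x. f' (g' x)) (\<lambda>x. x)" and c: "c \<in> U"
    using assms(2) unfolding based_equiv_def by blast
  have "homotopic_with_canon (\<lambda>k. k b = a) T S (g \<circ> (\<lambda>x. g' (f' x))) (g \<circ> (\<lambda>x. x))"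
    by (rule homotopic_with_compose_continuous_map_left[OF gf']) (use g in auto)
  then have "homotopic_with_canon (\<lambda>k. k a = a) S S (g \<circ> (\<lambda>x. g' (f' x)) \<circ> f) (g \<circ> (\<lambda>x. x) \<circ> f)"
    by (rule homotopic_with_compose_continuous_map_right) (use f in auto)
  then have 1: "homotopic_with_canon (\<lambda>k. k a = a) S S (\<lambda>x. g (g' (f' (f x)))) (\<lambda>x. x)"
    using gf by (simp add: o_def) (rule homotopic_with_trans)
  have "homotopic_with_canon (\<lambda>k. k b = c) T U (f' \<circ> (\<lambda>x. f (g x))) (f' \<circ> (\<lambda>x. x))"
    by (rule homotopic_with_compose_continuous_map_left[OF fg]) (use f' in auto)
  then have "homotopic_with_canon (\<lambda>k. k c = c) U U (f' \<circ> (\<lambda>x. f (g x)) \<circ> g') (f' \<circ> (\<lambda>x. x) \<circ> g')"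
    by (rule homotopic_with_compose_continuous_map_right) (use g' in auto)
  then have 2: "homotopic_with_canon (\<lambda>k. k c = c) U U (\<lambda>x. f' (f (g (g' x)))) (\<lambda>x. x)"
    using fg' by (simp add: o_def) (rule homotopic_with_trans)
  have "continuous_on S (\<lambda>x. f' (f x))" "continuous_on U (\<lambda>x. g (g' x))"
    using continuous_on_compose2[OF f'(1) f(1,2)] continuous_on_compose2[OF g(1) g'(1,2)] by auto
  then show ?thesis
    unfolding based_equiv_def using a c f f' g g' 1 2
    by (intro conjI exI[of _ "\<lambda>x. f' (f x)"] exI[of _ "\<lambda>x. g (g' x)"]) (auto simp: image_subset_iff)
qed

text \<open>Where the last coordinate is not 1, all others lie on their circles, so it can be moved
  to 1 through its disc: a deformation retraction onto \<open>moment_angle m\<close>.\<close>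

lemma based_equiv_stage_0: "based_equiv (stage m 0) (\<lambda>_. 1) (moment_angle m) (\<lambda>_. 1)"
proof -
  let ?S = "stage m 0"
  define r where "r z = z(Suc m := 1)" for z :: "nat \<Rightarrow> complex"
  have cr: "continuous_on X r" for X
    unfolding r_def by (rule continuous_on_coordinatewise_then_product) (intro continuous_intros)
  have sub: "moment_angle m \<subseteq> ?S" by (auto simp: moment_angle_def stage_def)
  have rS: "r z \<in> moment_angle m" if "z \<in> ?S" for z
    using that by (auto simp: moment_angle_def stage_def r_def)
  have rid: "r z = z" if "z \<in> moment_angle m" for z
    using moment_angle_outside[OF that, of "Suc m"] by (auto simp: r_def)
  have c: "continuous_on ({0..1::real} \<times> ?S) (\<lambda>y. snd y i)" for i
    by (intro continuous_intros)
  have "homotopic_with_canon (\<lambda>k. k (\<lambda>_. 1) = (\<lambda>_. 1)) ?S ?S (\<lambda>z. z) r"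
  proof (rule homotopic_with_canonI[where h = "\<lambda>t z. z(Suc m := (1 - of_real t) * z (Suc m) + of_real t)"])
    show "continuous_on ({0..1} \<times> ?S)
      (\<lambda>y. (snd y)(Suc m := (1 - of_real (fst y)) * snd y (Suc m) + of_real (fst y)))"
      by (rule continuous_on_coordinatewise_then_product) (intro c continuous_intros)
    fix t :: real and z assume t: "0 \<le> t" "t \<le> 1" and z: "z \<in> ?S"
    let ?z = "z(Suc m := (1 - of_real t) * z (Suc m) + of_real t)"
    show "?z \<in> ?S"
    proof (cases "z (Suc m) = 1")
      case True
      then have "?z = z" by auto
      then show ?thesis using z by simp
    next
      case False
      then have z': "z \<in> moment_angle (Suc m)" "\<And>j. j \<in> {0<..m} \<Longrightarrow> square_norm (z j) = 1"
        using z by (auto simp: stage_def)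
      have 1: "square_norm (z j) = 1" if "j \<noteq> Suc m" for j
        using z'(2)[of j] moment_angle_outside[OF z'(1), of j] that by (cases "j \<in> {0<..m}") auto
      have "?z \<in> moment_angle (Suc m)"
        using t z'(1) 1 by (intro moment_angle_segment)
      then show ?thesis using z'(2) by (auto simp: stage_def)
    qed
  next
    show "h (\<lambda>_. 1) = (\<lambda>_. 1) \<longleftrightarrow> k (\<lambda>_. 1) = (\<lambda>_. 1)" if "\<And>x. x \<in> ?S \<Longrightarrow> h x = k x"
      for h k :: "(nat \<Rightarrow> complex) \<Rightarrow> nat \<Rightarrow> complex"
      using that[of "\<lambda>_. 1"] by (auto simp: stage_def moment_angle_def)
  qed (auto simp: r_def)
  then have 1: "homotopic_with_canon (\<lambda>k. k (\<lambda>_. 1) = (\<lambda>_. 1)) ?S ?S r (\<lambda>z. z)"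
    by (rule homotopic_with_symD)
  have "homotopic_with_canon (\<lambda>k. k (\<lambda>_. 1) = (\<lambda>_. 1)) (moment_angle m) (moment_angle m) r (\<lambda>z. z)"
    by (rule homotopic_with_equal) (use rid in \<open>auto simp: cr r_def\<close>)
  moreover have "(\<lambda>_. 1) \<in> moment_angle m" by (auto simp: moment_angle_def)
  ultimately show ?thesis
    unfolding based_equiv_def using 1 sub rS cr rid
    by (intro conjI exI[of _ r] exI[of _ "\<lambda>z. z"]) (auto simp: continuous_on_id)
qed

lemma based_equiv_singleton: "based_equiv {a} a {b} b"
  unfolding based_equiv_def
  by (intro conjI exI[of _ "\<lambda>_. b"] exI[of _ "\<lambda>_. a"] homotopic_with_equal) auto

theorem based_equiv_moment_angle:
  "based_equiv (moment_angle m) (\<lambda>_. 1) (bouquet (\<lambda>k. (k - 1) * (m choose k))) bouquet_base"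
proof (induction m)
  case 0
  have "moment_angle 0 = {\<lambda>_. 1}" by (auto simp: moment_angle_def)
  \<comment> \<open>At \<open>k = 0\<close> the binomial is 1, but the truncated factor
    \<open>k - 1\<close> vanishes.\<close>
  moreover have "(\<lambda>k. (k - 1) * (0 choose k)) = (\<lambda>_. 0)" by (auto simp: binomial_eq_0)
  moreover have "bouquet (\<lambda>_. 0) = {bouquet_base}" by (auto simp: bouquet_def)
  ultimately show ?case by (simp only: based_equiv_singleton)
next
  case (Suc m)
  let ?c = "\<lambda>k. (k - 1) * (m choose k)" and ?b = "\<lambda>k. if 2 \<le> k then (m - 1) choose (k - 2) else 0"
  have "based_equiv (stage m i) (\<lambda>_. 1) (bouquet (\<lambda>k. ?c k + i * ?b k)) bouquet_base" if "i \<le> m" for i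
    using that
  proof (induction i)
    case 0
    show ?case using based_equiv_trans[OF based_equiv_stage_0 Suc.IH] by simp
  next
    case (Suc i)
    then have "based_equiv (stage m (Suc i - 1)) (\<lambda>_. 1) (bouquet (\<lambda>k. ?c k + i * ?b k)) bouquet_base" by simp
    from based_equiv_stage_step[OF _ _ refl refl this] Suc.prems show ?case
      by (simp add: algebra_simps)
  qed
  from this[OF order_refl]
  have "based_equiv (stage m m) (\<lambda>_. 1) (bouquet (\<lambda>k. ?c k + m * ?b k)) bouquet_base" .
  moreover have "stage m m = moment_angle (Suc m)" by (auto simp: stage_def)
  moreover have "?c k + m * ?b k = (k - 1) * (Suc m choose k)" for k
  proof (cases "2 \<le> k")
    case True
    then obtain l where l: "k = Suc (Suc l)" by (metis add_2_eq_Suc le_Suc_ex)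
    \<comment> \<open>After Pascal's rule the new term is
      \<open>(k - 1) * (m choose (k - 1))\<close>; absorption turns it into the \<open>m\<close>
      equal contributions of the stages.\<close>
    have "Suc l * (m choose Suc l) = m * ((m - 1) choose l)" by (rule binomial_absorption)
    then show ?thesis by (simp add: l algebra_simps)
  next
    case False
    \<comment> \<open>The factor \<open>k - 1\<close> is 0 in both cases, by truncation for
      \<open>k = 0\<close>.\<close>
    then have "k = 0 \<or> k = 1" by auto
    then show ?thesis by auto
  qed
  ultimately show ?case by simp
qed

section \<open>The arrangement complement\<close>

lemma based_equiv_imp_homotopy_equivalent_space:
  assumes "based_equiv S a T b"
  shows "top_of_set S homotopy_equivalent_space top_of_set T"
proof -
  obtain f g where f: "continuous_on S f" "f ` S \<subseteq> T" and g: "continuous_on T g" "g ` T \<subseteq> S"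
    and gf: "homotopic_with_canon (\<lambda>k. k a = a) S S (\<lambda>x. g (f x)) (\<lambda>x. x)"
    and fg: "homotopic_with_canon (\<lambda>k. k b = b) T T (\<lambda>x. f (g x)) (\<lambda>x. x)"
    using assms unfolding based_equiv_def by blast
  have "homotopic_with_canon (\<lambda>_. True) S S (g \<circ> f) id" "homotopic_with_canon (\<lambda>_. True) T T (f \<circ> g) id"
    using homotopic_with_mono[OF gf, of "\<lambda>_. True"] homotopic_with_mono[OF fg, of "\<lambda>_. True"]
    by (simp_all add: o_def id_def)
  then show ?thesis
    unfolding homotopy_equivalent_space_def using f g
    by (intro exI[of _ f] exI[of _ g]) (auto simp: image_subset_iff)
qed

text \<open>The spare value \<open>undefined\<close> is replaced by 1: being nonzero it creates no
  new vanishing pairs, and it agrees with the convention of \<open>moment_angle\<close>.\<close>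

definition arrangement_model :: "nat \<Rightarrow> (nat \<Rightarrow> complex) set" where
  "arrangement_model n = {z. (\<forall>i. i \<notin> {1..n} \<longrightarrow> z i = 1) \<and> (\<forall>i j. i \<noteq> j \<longrightarrow> z i \<noteq> 0 \<or> z j \<noteq> 0)}"

lemma topspace_codim2_complement:
  "topspace (codim2_complement n) =
     {z \<in> {1..n} \<rightarrow>\<^sub>E UNIV. \<forall>i\<in>{1..n}. \<forall>j\<in>{1..n}. i \<noteq> j \<longrightarrow> z i \<noteq> 0 \<or> z j \<noteq> 0}"
proof -
  have *: "z \<in> \<Union> (codim2_arrangement n) \<longleftrightarrow>
      z \<in> {1..n} \<rightarrow>\<^sub>E UNIV \<and> (\<exists>i\<in>{1..n}. \<exists>j\<in>{1..n}. i \<noteq> j \<and> z i = 0 \<and> z j = 0)" (is "?l \<longleftrightarrow> ?r") for z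
  proof
    assume ?r
    then obtain i j where ij: "i \<in> {1..n}" "j \<in> {1..n}" "i \<noteq> j" "z i = 0" "z j = 0"
      and z: "z \<in> {1..n} \<rightarrow>\<^sub>E UNIV" by blast
    have "\<exists>i j. 1 \<le> i \<and> i < j \<and> j \<le> n \<and> z i = 0 \<and> z j = 0"
    proof (cases "i < j")
      case True
      then show ?thesis using ij by auto
    next
      case False
      then have "j < i" using ij by simp
      then show ?thesis using ij by auto
    qed
    then show ?l using z unfolding codim2_arrangement_def complex_space_def by auto
  next
    assume ?l
    then obtain i j where ij: "1 \<le> i" "i < j" "j \<le> n" "z i = 0" "z j = 0"
      and z: "z \<in> topspace (complex_space n)"
      unfolding codim2_arrangement_def by blast
    have "i \<in> {1..n}" "j \<in> {1..n}" "i \<noteq> j" using ij by auto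
    moreover have "z \<in> {1..n} \<rightarrow>\<^sub>E UNIV" using z by (simp add: complex_space_def)
    ultimately show ?r using ij(4,5) by blast
  qed
  have "topspace (codim2_complement n) = ({1..n} \<rightarrow>\<^sub>E UNIV) - \<Union> (codim2_arrangement n)"
    by (auto simp: codim2_complement_def complex_space_def)
  moreover have "(\<exists>i\<in>A. \<exists>j\<in>A. i \<noteq> j \<and> z i = 0 \<and> z j = 0) \<longleftrightarrow>
      \<not> (\<forall>i\<in>A. \<forall>j\<in>A. i \<noteq> j \<longrightarrow> z i \<noteq> 0 \<or> z j \<noteq> 0)" for A and z :: "nat \<Rightarrow> complex"
    by blast
  ultimately show ?thesis
    by (simp only: set_eq_iff Diff_iff * mem_Collect_eq, intro allI, argo)
qed

lemma homeomorphic_codim2_complement: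
  "codim2_complement n homeomorphic_space top_of_set (arrangement_model n)"
proof -
  let ?f = "\<lambda>z i. if i \<in> {1..n} then z i else (1 :: complex)"
  let ?g = "\<lambda>z. restrict z {1..n}"
  let ?X = "codim2_complement n"
  have "continuous_map ?X euclidean (\<lambda>z. ?f z i)" for i
    by (cases "i \<in> {1..n}")
       (auto simp: codim2_complement_def complex_space_def
         intro!: continuous_map_from_subtopology continuous_map_product_projection)
  then have "continuous_map ?X (product_topology (\<lambda>_. euclidean) UNIV) ?f"
    by (simp add: continuous_map_componentwise_UNIV)
  then have "continuous_map ?X (top_of_set (arrangement_model n)) ?f"
    by (simp add: continuous_map_in_subtopology euclidean_product_topology)
       (auto simp: topspace_codim2_complement arrangement_model_def)
  moreover have "continuous_map (top_of_set (arrangement_model n)) (complex_space n) ?g"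
    unfolding complex_space_def continuous_map_componentwise
    by (auto intro: continuous_on_apply)
  then have "continuous_map (top_of_set (arrangement_model n)) ?X ?g"
    unfolding codim2_complement_def continuous_map_in_subtopology
    using topspace_codim2_complement[of n]
    by (auto simp: codim2_complement_def complex_space_def arrangement_model_def)
  moreover have "?g (?f z) = z" if "z \<in> topspace ?X" for z
    using that by (auto simp: topspace_codim2_complement PiE_iff extensional_def restrict_def)
  moreover have "?f (?g z) = z" if "z \<in> arrangement_model n" for z
    using that by (auto simp: arrangement_model_def)
  ultimately show ?thesis
    unfolding homeomorphic_space_def homeomorphic_maps_def
    by (intro exI[of _ ?f] exI[of _ ?g]) auto
qed

text \<open>The second smallest coordinate in absolute value, capped at 1.\<close>

definition threshold :: "nat \<Rightarrow> (nat \<Rightarrow> complex) \<Rightarrow> real" where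
  "threshold n z = Min (insert 1 ((\<lambda>(i, j). max (square_norm (z i)) (square_norm (z j))) ` {(i, j) \<in> {1..n} \<times> {1..n}. i \<noteq> j}))"

lemma finite_pairs: "finite {(i, j) \<in> {1..n} \<times> {1..n}. i \<noteq> (j :: nat)}"
  by (rule finite_subset[of _ "{1..n} \<times> {1..n}"]) auto

lemma threshold_le: "threshold n z \<le> 1"
  "\<lbrakk>i \<in> {1..n}; j \<in> {1..n}; i \<noteq> j\<rbrakk> \<Longrightarrow> threshold n z \<le> max (square_norm (z i)) (square_norm (z j))"
  unfolding threshold_def by (rule Min_le; use finite_pairs[of n] in auto)+

lemma threshold_greater_iff: "c < threshold n z \<longleftrightarrow> c < 1 \<and>
   (\<forall>i\<in>{1..n}. \<forall>j\<in>{1..n}. i \<noteq> j \<longrightarrow> c < max (square_norm (z i)) (square_norm (z j)))"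
  unfolding threshold_def using finite_pairs[of n] by (subst Min_gr_iff) auto

lemma threshold_ge_iff: "c \<le> threshold n z \<longleftrightarrow> c \<le> 1 \<and>
   (\<forall>i\<in>{1..n}. \<forall>j\<in>{1..n}. i \<noteq> j \<longrightarrow> c \<le> max (square_norm (z i)) (square_norm (z j)))"
  unfolding threshold_def using finite_pairs[of n] by (subst Min_ge_iff) auto

lemma continuous_on_Min_insert:
  fixes f :: "'p \<Rightarrow> 'a::topological_space \<Rightarrow> real"
  assumes "finite P" "\<And>p. p \<in> P \<Longrightarrow> continuous_on S (f p)"
  shows "continuous_on S (\<lambda>x. Min (insert c ((\<lambda>p. f p x) ` P)))"
  using assms
proof (induction P rule: finite_induct)
  case (insert p P)
  have "Min (insert c ((\<lambda>p. f p x) ` insert p P)) = min (f p x) (Min (insert c ((\<lambda>p. f p x) ` P)))" for x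
    using insert.hyps(1) by (simp add: insert_commute[of c])
  then show ?case using insert by (simp add: continuous_on_min)
qed simp

lemma continuous_on_threshold: "continuous_on S (threshold n)"
  unfolding threshold_def case_prod_unfold
  by (rule continuous_on_Min_insert) (use finite_pairs[of n] in \<open>auto intro!: continuous_intros\<close>)

text \<open>Divide each coordinate by the larger of its norm and the threshold. Coordinates reaching
  the threshold get norm 1, and at most one falls below it, since the threshold is at most the
  maximum over any pair; that one ends up in the disc.\<close>

lemma based_equiv_arrangement_model: "based_equiv (arrangement_model n) (\<lambda>_. 1) (moment_angle n) (\<lambda>_. 1)"
proof -
  let ?U = "arrangement_model n" and ?Z = "moment_angle n" and ?s = "threshold n"
  define \<mu> where "\<mu> z i = max (square_norm (z i)) (?s z)" for z i
  define h where "h t z i = of_real ((1 - t) + t * inverse (\<mu> z i)) * z i" for t z i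
  have s0: "0 < ?s z" if "z \<in> ?U" for z
  proof -
    have "0 < max (square_norm (z i)) (square_norm (z j))" if "i \<noteq> j" for i j
    proof -
      have "z i \<noteq> 0 \<or> z j \<noteq> 0" using that \<open>z \<in> ?U\<close> by (simp add: arrangement_model_def)
      then show ?thesis using square_norm_pos[of "z i"] square_norm_pos[of "z j"] by (auto simp: less_max_iff_disj)
    qed
    then show ?thesis by (simp add: threshold_greater_iff)
  qed
  then have \<mu>0: "0 < \<mu> z i" if "z \<in> ?U" for z i
    using that by (simp add: \<mu>_def less_max_iff_disj)
  have \<mu>_nz: "max (square_norm (z i)) (?s z) \<noteq> 0" if "z \<in> ?U" for z i
    using less_imp_neq[OF \<mu>0[OF that, of i]] unfolding \<mu>_def by (rule not_sym)
  \<comment> \<open>Here the cap at 1 matters: it leaves the spare coordinates, which are 1,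
    untouched.\<close>
  have \<mu>1: "\<mu> z i = 1" if "square_norm (z i) = 1" for z i
    using that threshold_le(1)[of n z] by (simp add: \<mu>_def)
  have out: "h t z i = 1" if "z \<in> ?U" "i \<notin> {1..n}" for t z i
  proof -
    have "z i = 1" using that by (simp add: arrangement_model_def)
    then show ?thesis using \<mu>1[of z i] by (simp add: h_def)
  qed
  have hU: "h t z \<in> ?U" if t: "0 \<le> t" "t \<le> 1" and z: "z \<in> ?U" for t z
  proof -
    \<comment> \<open>A positive factor keeps the set of vanishing coordinates, so the homotopy
      never meets the arrangement.\<close>
    have "0 < (1 - t) + t * inverse (\<mu> z i)" for i
    proof (cases "t = 0")
      case False
      then have "0 < t * inverse (\<mu> z i)" using t \<mu>0[OF z] by simp
      then show ?thesis using t by linarith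
    qed simp
    then have "h t z i = 0 \<longleftrightarrow> z i = 0" for i
      unfolding h_def by (metis less_irrefl mult_eq_0_iff of_real_eq_0_iff)
    then show ?thesis using out[OF z] z by (auto simp: arrangement_model_def)
  qed
  have h1: "square_norm (h 1 z i) = square_norm (z i) / \<mu> z i" if "z \<in> ?U" for z i
    unfolding h_def square_norm_of_real_mult using \<mu>0[OF that, of i] by (simp add: field_simps)
  have rZ: "h 1 z \<in> ?Z" if z: "z \<in> ?U" for z
  proof -
    have "square_norm (h 1 z i) \<le> 1" for i
      unfolding h1[OF z] using \<mu>0[OF z, of i] by (simp add: \<mu>_def)
    moreover have "square_norm (h 1 z i) = 1 \<or> square_norm (h 1 z j) = 1" if "i \<noteq> j" for i j
    proof -
      have "?s z \<le> max (square_norm (z i)) (square_norm (z j))"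
      proof (cases "i \<in> {1..n} \<and> j \<in> {1..n}")
        case True
        then show ?thesis using that by (intro threshold_le(2)) auto
      next
        case False
        then have "z i = 1 \<or> z j = 1" using z by (auto simp: arrangement_model_def)
        then show ?thesis using threshold_le(1)[of n z] by (auto simp: le_max_iff_disj)
      qed
      then have "\<mu> z i = square_norm (z i) \<or> \<mu> z j = square_norm (z j)" by (auto simp: \<mu>_def)
      then show ?thesis using \<mu>0[OF z, of i] \<mu>0[OF z, of j] by (auto simp: h1[OF z])
    qed
    ultimately show ?thesis using out[OF z] by (auto simp: moment_angle_def)
  qed
  have ZU: "?Z \<subseteq> ?U"
  proof
    fix z assume z: "z \<in> ?Z"
    have "z i \<noteq> 0 \<or> z j \<noteq> 0" if "i \<noteq> j" for i j
    proof -
      have "square_norm (z i) = 1 \<or> square_norm (z j) = 1" using z that by (simp add: moment_angle_def)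
      then show ?thesis using square_norm_eq_0_iff[of "z i"] square_norm_eq_0_iff[of "z j"] by auto
    qed
    then show "z \<in> ?U" using z by (simp add: arrangement_model_def moment_angle_def)
  qed
  have hZ: "h t z = z" if z: "z \<in> ?Z" for t z
  proof -
    have "1 \<le> max (square_norm (z i)) (square_norm (z j))" if "i \<noteq> j" for i j
    proof -
      have "square_norm (z i) = 1 \<or> square_norm (z j) = 1" using z that by (simp add: moment_angle_def)
      then show ?thesis by (auto simp: le_max_iff_disj)
    qed
    then have "1 \<le> ?s z" by (simp add: threshold_ge_iff)
    then have "?s z = 1" using threshold_le(1)[of n z] by simp
    then have "\<mu> z i = 1" for i using z by (simp add: \<mu>_def moment_angle_def)
    then show ?thesis by (simp add: h_def fun_eq_iff)
  qed
  have ch: "continuous_on ({0..1} \<times> ?U) (\<lambda>y. h (fst y) (snd y))"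
  proof (rule continuous_on_coordinatewise_then_product)
    fix i
    have s: "continuous_on ({0..1::real} \<times> ?U) (\<lambda>y. ?s (snd y))"
      by (rule continuous_on_compose2[OF continuous_on_threshold[of UNIV]]) (auto intro: continuous_on_snd continuous_on_id)
    show "continuous_on ({0..1} \<times> ?U) (\<lambda>y. h (fst y) (snd y) i)"
      unfolding h_def \<mu>_def
      by (intro continuous_intros s ballI) (rule \<mu>_nz, auto)
  qed
  have one: "(\<lambda>_. 1) \<in> ?Z" by (auto simp: moment_angle_def)
  have cr: "continuous_on ?U (h 1)"
    by (rule continuous_on_curried_compose[OF ch]) (auto intro: continuous_intros)
  have "homotopic_with_canon (\<lambda>k. k (\<lambda>_. 1) = (\<lambda>_. 1)) ?U ?U (\<lambda>z. z) (h 1)"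
  proof (rule homotopic_with_canonI[OF ch])
    show "f (\<lambda>_. 1) = (\<lambda>_. 1) \<longleftrightarrow> k (\<lambda>_. 1) = (\<lambda>_. 1)" if "\<And>x. x \<in> ?U \<Longrightarrow> f x = k x"
      for f k :: "(nat \<Rightarrow> complex) \<Rightarrow> nat \<Rightarrow> complex"
      using that[of "\<lambda>_. 1"] one ZU by auto
  qed (use hU hZ[OF one] in \<open>auto simp: h_def[of 0]\<close>)
  then have 1: "homotopic_with_canon (\<lambda>k. k (\<lambda>_. 1) = (\<lambda>_. 1)) ?U ?U (h 1) (\<lambda>z. z)"
    by (rule homotopic_with_symD)
  have 2: "homotopic_with_canon (\<lambda>k. k (\<lambda>_. 1) = (\<lambda>_. 1)) ?Z ?Z (h 1) (\<lambda>z. z)"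
    by (rule homotopic_with_equal)
       (use hZ hZ[OF one] ZU in \<open>auto intro: continuous_on_subset[OF cr]\<close>)
  show ?thesis
    unfolding based_equiv_def
    by (intro conjI exI[of _ "h 1"] exI[of _ "\<lambda>z. z"])
       (use 1 2 one ZU rZ cr hZ[OF one] in \<open>auto simp: continuous_on_id\<close>)
qed

section \<open>Bouquets as wedges\<close>

lemma continuous_map_wedge_incl:
  assumes "i \<in> I"
  shows "continuous_map (X i) (wedge X b I) (wedge_incl b i)"
  unfolding continuous_map_def openin_wedge
  using assms by (auto simp: wedge_carrier_def)

text \<open>The final topology reduces continuity to the summands; the condition at
  \<open>None\<close> supplies the base point also when \<open>I\<close> is empty.\<close>

lemma continuous_map_from_wedge:
  assumes "\<And>i. i \<in> I \<Longrightarrow> continuous_map (X i) Y (\<lambda>x. f (wedge_incl b i x))" "f None \<in> topspace Y"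
  shows "continuous_map (wedge X b I) Y f"
  unfolding continuous_map_def
proof (intro conjI allI impI)
  show "f \<in> topspace (wedge X b I) \<rightarrow> topspace Y"
    using assms by (auto simp: wedge_carrier_def continuous_map_def)
  fix U assume U: "openin Y U"
  have "{x \<in> topspace (X i). wedge_incl b i x \<in> {w \<in> wedge_carrier X b I. f w \<in> U}}
      = {x \<in> topspace (X i). f (wedge_incl b i x) \<in> U}" if "i \<in> I" for i
    using that by (auto simp: wedge_carrier_def)
  then show "openin (wedge X b I) {w \<in> topspace (wedge X b I). f w \<in> U}"
    unfolding openin_wedge topspace_wedge using assms(1) U by (auto simp: continuous_map_def)
qed

lemma compact_space_wedge:
  assumes "finite I" "\<And>i. i \<in> I \<Longrightarrow> compact_space (X i)"
  shows "compact_space (wedge X b I)"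
proof -
  have "compactin (wedge X b I) (wedge_incl b i ` topspace (X i))" if "i \<in> I" for i
    using that assms(2) by (intro image_compactin[OF _ continuous_map_wedge_incl]) (auto simp: compact_space_def)
  then have "compactin (wedge X b I) (\<Union>i\<in>I. wedge_incl b i ` topspace (X i))"
    using assms(1) by (intro compactin_Union) auto
  moreover have "compactin (wedge X b I) {None}"
    by (simp add: wedge_carrier_def)
  ultimately have "compactin (wedge X b I) ({None} \<union> (\<Union>i\<in>I. wedge_incl b i ` topspace (X i)))"
    by (intro compactin_Un)
  then show ?thesis by (simp add: compact_space_def wedge_carrier_def)
qed

lemma nsphere_eq: "nsphere d = top_of_set (unit_sphere d)"
  by (simp add: nsphere unit_sphere_def euclidean_product_topology)

lemma compact_unit_sphere: "compact (unit_sphere d)"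
proof -
  have "unit_sphere d \<subseteq> cube {..d}"
  proof
    fix x assume x: "x \<in> unit_sphere d"
    have "(x i)\<^sup>2 \<le> (\<Sum>i\<le>d. (x i)\<^sup>2)" if "i \<le> d" for i
      using that by (intro member_le_sum) auto
    then show "x \<in> cube {..d}" using x by (auto simp: unit_sphere_def cube_def abs_square_le_1)
  qed
  then show ?thesis
    using compact_Int_closed[OF compact_cube closed_unit_sphere] by (metis inf.absorb_iff2)
qed

text \<open>A finite wedge of spheres is compact and the bouquet is Hausdorff, so a continuous
  bijection suffices.\<close>

lemma wedge_of_spheres_homeomorphic_bouquet:
  assumes c: "\<And>k. c k \<noteq> 0 \<Longrightarrow> k \<in> M" and M: "finite M"
  shows "wedge_of_spheres M c (\<lambda>k. k + 1) homeomorphic_space top_of_set (bouquet c)"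
proof -
  let ?I = "SIGMA k:M. {..<c k}" and ?X = "\<lambda>(k, j :: nat). nsphere (k + 1)" and ?b = "\<lambda>_. sphere_base"
  define f :: "((nat \<times> nat) \<times> (nat \<Rightarrow> real)) option \<Rightarrow> nat \<times> nat \<Rightarrow> nat \<Rightarrow> real"
    where "f w = (case w of None \<Rightarrow> bouquet_base | Some (i, x) \<Rightarrow> bouquet_base(i := x))" for w
  have f_incl: "f (wedge_incl ?b i x) = bouquet_base(i := x)" for i x
    by (auto simp: f_def wedge_incl_def)
  have X: "?X i = top_of_set (unit_sphere (Suc (fst i)))" for i
    by (simp add: case_prod_unfold nsphere_eq)
  have in_bouquet: "bouquet_base(i := x) \<in> bouquet c" if "i \<in> ?I" "x \<in> unit_sphere (Suc (fst i))" for i x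
    using that by (auto simp: bouquet_def)
  have base: "bouquet_base \<in> bouquet c" by (simp add: bouquet_def)
  have "continuous_map (wedge ?X ?b ?I) (top_of_set (bouquet c)) f"
  proof (rule continuous_map_from_wedge)
    fix i assume i: "i \<in> ?I"
    have "continuous_on S (\<lambda>x. bouquet_base(i := x))" for S :: "(nat \<Rightarrow> real) set"
      by (rule continuous_on_coordinatewise_then_product) (intro continuous_on_fun_upd continuous_intros)
    then show "continuous_map (?X i) (top_of_set (bouquet c)) (\<lambda>x. f (wedge_incl ?b i x))"
      unfolding X f_incl using in_bouquet[OF i] by auto
  qed (simp add: f_def base)
  moreover have "compact_space (wedge ?X ?b ?I)"
  proof (rule compact_space_wedge)
    show "finite ?I" using M by simp
    show "compact_space (?X i)" for i
      unfolding X using compact_unit_sphere by (simp add: compact_space_subtopology)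
  qed
  moreover have "Hausdorff_space (top_of_set (bouquet c))"
    by (intro Hausdorff_space_subtopology Hausdorff_space_euclidean_t2)
  moreover have carrier: "wedge_carrier ?X ?b ?I
      = insert None (Some ` {(i, x). i \<in> ?I \<and> x \<in> unit_sphere (Suc (fst i)) \<and> x \<noteq> sphere_base})"
    unfolding wedge_carrier_def X by (force simp: wedge_incl_def)
  have "f ` topspace (wedge ?X ?b ?I) = topspace (top_of_set (bouquet c))"
  proof -
    have "w \<in> f ` topspace (wedge ?X ?b ?I)" if w: "w \<in> bouquet c" for w
    proof (cases "w = bouquet_base")
      case True
      then show ?thesis unfolding topspace_wedge carrier by (auto simp: f_def)
    next
      case False
      then obtain k j where kj: "w (k, j) \<noteq> sphere_base" by fastforce
      then have j: "j < c k" "w (k, j) \<in> unit_sphere (Suc k)"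
        using w unfolding bouquet_def mem_Collect_eq by metis+
      then have "(k, j) \<in> ?I" using c[of k] by auto
      moreover have "w p = sphere_base" if "p \<noteq> (k, j)" for p
        using w kj that unfolding bouquet_def by blast
      then have "w = f (Some ((k, j), w (k, j)))" by (auto simp: f_def)
      ultimately show ?thesis
        unfolding topspace_wedge carrier using kj j by (intro image_eqI) auto
    qed
    moreover have "f w \<in> bouquet c" if "w \<in> topspace (wedge ?X ?b ?I)" for w
      using that unfolding topspace_wedge carrier by (auto simp: f_def base in_bouquet)
    ultimately show ?thesis by auto
  qed
  moreover have "inj_on f (topspace (wedge ?X ?b ?I))"
  proof (rule inj_onI)
    fix v w assume vw: "v \<in> topspace (wedge ?X ?b ?I)" "w \<in> topspace (wedge ?X ?b ?I)" "f v = f w"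
    \<comment> \<open>The coordinate off the base point names the summand, and its value there is
      the point of the sphere.\<close>
    have supp: "{p. f u p \<noteq> sphere_base} = (case u of None \<Rightarrow> {} | Some (i, x) \<Rightarrow> {i})"
      if "u \<in> topspace (wedge ?X ?b ?I)" for u
      using that unfolding topspace_wedge carrier by (auto simp: f_def split: option.splits)
    have "(case v of None \<Rightarrow> {} | Some (i, x) \<Rightarrow> {i}) = (case w of None \<Rightarrow> {} | Some (i, x) \<Rightarrow> {i})"
      using supp[OF vw(1)] supp[OF vw(2)] vw(3) by simp
    then show "v = w"
      using vw(3) by (auto simp: f_def split: option.splits) (metis fun_upd_same)+
  qed
  ultimately have "homeomorphic_map (wedge ?X ?b ?I) (top_of_set (bouquet c)) f"
    by (intro continuous_imp_homeomorphic_map)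
  then show ?thesis
    unfolding wedge_of_spheres_def by (rule homeomorphic_map_imp_homeomorphic_space)
qed

theorem theorem1:
  fixes n :: nat
  assumes "n \<ge> 1"
  shows "codim2_complement n homotopy_equivalent_space
           wedge_of_spheres {2..n} (\<lambda>k. (k - 1) * (n choose k)) (\<lambda>k. k + 1)"
proof -
  let ?c = "\<lambda>k. (k - 1) * (n choose k)"
  \<comment> \<open>Outside this range the factor \<open>k - 1\<close> or the binomial vanishes, so
    the wedge over \<open>{2..n}\<close> has all the spheres of the bouquet.\<close>
  have "k \<in> {2..n}" if "?c k \<noteq> 0" for k
    using that binomial_eq_0[of n k] by (cases "k \<le> n") auto
  then have "wedge_of_spheres {2..n} ?c (\<lambda>k. k + 1) homeomorphic_space top_of_set (bouquet ?c)"
    by (intro wedge_of_spheres_homeomorphic_bouquet) auto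
  then have "top_of_set (bouquet ?c) homotopy_equivalent_space wedge_of_spheres {2..n} ?c (\<lambda>k. k + 1)"
    using homeomorphic_imp_homotopy_equivalent_space homeomorphic_space_sym by blast
  moreover have "top_of_set (arrangement_model n) homotopy_equivalent_space top_of_set (bouquet ?c)"
    using based_equiv_trans[OF based_equiv_arrangement_model based_equiv_moment_angle] by (rule based_equiv_imp_homotopy_equivalent_space)
  moreover have "codim2_complement n homotopy_equivalent_space top_of_set (arrangement_model n)"
    using homeomorphic_codim2_complement by (rule homeomorphic_imp_homotopy_equivalent_space)
  ultimately show ?thesis
    by (meson homotopy_eqv_trans)
qed

end
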